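(* A real-valued distribution $q\in H^{-1}(\mathbb{R})$ belongs to $\operatorname{Im}(B_0)$ if and only if: (i) $L_q\geq0$, and (ii) the special integral $[q]$ exists. Moreover, for any $q\in\operatorname{Im}(B_0)$, one has $[q]\ge 0$.
   Context: $H^{-1}(\mathbb{R})$ is the usual $L^2$-based Sobolev space of order $-1$. $B_0:L^2(\mathbb{R})\to H^{-1}(\mathbb{R})$ is the Miura map $B_0(r)=r'+r^2$ (distributional derivative) on real-valued functions in $L^2(\mathbb{R})$, and $\operatorname{Im}(B_0)$ is its image. For real-valued $q\in H^{-1}_{\mathrm{loc}}(\mathbb{R})$, $L_q=-d^2/dx^2+q$, and $L_q\ge 0$ means $(L_q\varphi,\varphi)=\int_{\mathbb{R}}|\varphi'|^2\,dx+(q,|\varphi|^2)\ge 0$ for all $\varphi\in C_0^\infty(\mathbb{R})$, where $(\cdot,\cdot)$ is the pairing of distributions with test functions extending the $L^2$ inner product. Special integral: let $\{\chi_n\}_{n\ge1}$ be a sequence of nonnegative $C_0^\infty(\mathbb{R})$ functions with $\chi_n(x)=1$ for $|x|\le n$, $\chi_n(x)=0$ for $|x|\ge n+1$, and $|\chi_n'(x)|\le 2$ for all $x\in\mathbb{R}$. For $q\in H^{-1}(\mathbb{R})$, the special integral $[q]$ is the number $\lim_{n\to\infty}(q,\chi_n)$ if this limit exists and is finite (the existence and value of the limit do not depend on the choice of such a sequence $\{\chi_n\}$). *)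

theory Defs
  imports "HOL-Analysis.Analysis"
begin

section \<open>Test functions and distributions on the real line\<close>

abbreviation vderiv :: "(real \<Rightarrow> 'a::real_normed_vector) \<Rightarrow> real \<Rightarrow> 'a" where
  "vderiv f \<equiv> (\<lambda>x. vector_derivative f (at x))"

definition smooth :: "(real \<Rightarrow> 'a::real_normed_vector) \<Rightarrow> bool" where
  "smooth f \<longleftrightarrow> (\<forall>n x. (vderiv ^^ n) f differentiable (at x))"

definition test_functions :: "(real \<Rightarrow> 'a::real_normed_vector) set" where
  "test_functions = {\<phi>. smooth \<phi> \<and> compact (closure {x. \<phi> x \<noteq> 0})}"

text \<open>
  A real-valued distribution is a continuous real-linear functional on the real test functions.
  It is made \<^const>\<open>extensional\<close>, so that equality of distributions is equality of
  HOL functions. Continuity is expressed by the usual seminorm estimates on compact sets.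
\<close>

definition distributions :: "((real \<Rightarrow> real) \<Rightarrow> real) set" where
  "distributions = {q \<in> extensional test_functions.
     (\<forall>\<phi>\<in>test_functions. \<forall>\<psi>\<in>test_functions. q (\<lambda>x. \<phi> x + \<psi> x) = q \<phi> + q \<psi>) \<and>
     (\<forall>c. \<forall>\<phi>\<in>test_functions. q (\<lambda>x. c * \<phi> x) = c * q \<phi>) \<and>
     (\<forall>K. compact K \<longrightarrow> (\<exists>C N. \<forall>\<phi>\<in>test_functions. {x. \<phi> x \<noteq> 0} \<subseteq> K \<longrightarrow>
        \<bar>q \<phi>\<bar> \<le> C * (\<Sum>k\<le>N. SUP x. \<bar>(vderiv ^^ k) \<phi> x\<bar>)))}"

definition H1_norm :: "(real \<Rightarrow> real) \<Rightarrow> real" where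
  "H1_norm \<phi> = sqrt ((LINT x|lborel. (\<phi> x)\<^sup>2) + (LINT x|lborel. (vderiv \<phi> x)\<^sup>2))"

text \<open>
  The Sobolev space of order \<open>-1\<close> is the dual of the Sobolev space of order \<open>1\<close>. Since test
  functions are dense in the latter, its elements are the distributions that are bounded
  with respect to the norm \<^const>\<open>H1_norm\<close>.
\<close>

definition H_minus1 :: "((real \<Rightarrow> real) \<Rightarrow> real) set" where
  "H_minus1 = {q \<in> distributions. \<exists>C. \<forall>\<phi>\<in>test_functions. \<bar>q \<phi>\<bar> \<le> C * H1_norm \<phi>}"


section \<open>The Miura map\<close>

text \<open>Elements of \<open>L\<^sup>2\<close> are given by representatives.\<close>

definition L2_functions :: "(real \<Rightarrow> real) set" where
  "L2_functions = {r \<in> borel_measurable lborel. integrable lborel (\<lambda>x. (r x)\<^sup>2)}"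

text \<open>The distribution \<open>r' + r\<^sup>2\<close>; the derivative is \<open>(r', \<phi>) = - (r, \<phi>')\<close>.\<close>

definition Miura :: "(real \<Rightarrow> real) \<Rightarrow> (real \<Rightarrow> real) \<Rightarrow> real" where
  "Miura r = restrict
     (\<lambda>\<phi>. - (LINT x|lborel. r x * vderiv \<phi> x) + (LINT x|lborel. (r x)\<^sup>2 * \<phi> x))
     test_functions"

definition Im_Miura :: "((real \<Rightarrow> real) \<Rightarrow> real) set" where
  "Im_Miura = Miura ` L2_functions"


section \<open>Nonnegativity of the Schroedinger operator\<close>

text \<open>The form \<open>(L\<^sub>q \<phi>, \<phi>)\<close> is evaluated on complex-valued test functions.\<close>

definition Schroedinger_form :: "((real \<Rightarrow> real) \<Rightarrow> real) \<Rightarrow> (real \<Rightarrow> complex) \<Rightarrow> real" where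
  "Schroedinger_form q \<phi> =
     (LINT x|lborel. (cmod (vderiv \<phi> x))\<^sup>2) + q (\<lambda>x. (cmod (\<phi> x))\<^sup>2)"

definition Schroedinger_nonneg :: "((real \<Rightarrow> real) \<Rightarrow> real) \<Rightarrow> bool" where
  "Schroedinger_nonneg q \<longleftrightarrow> (\<forall>\<phi>\<in>test_functions. Schroedinger_form q \<phi> \<ge> 0)"


section \<open>The special integral\<close>

text \<open>The sequence is indexed from \<open>1\<close>; its value at index \<open>0\<close> is irrelevant.\<close>

definition cutoff_sequence :: "(nat \<Rightarrow> real \<Rightarrow> real) \<Rightarrow> bool" where
  "cutoff_sequence \<eta> \<longleftrightarrow> (\<forall>n\<ge>1.
     \<eta> n \<in> test_functions \<and>
     (\<forall>x. \<eta> n x \<ge> 0) \<and>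
     (\<forall>x. \<bar>x\<bar> \<le> real n \<longrightarrow> \<eta> n x = 1) \<and>
     (\<forall>x. \<bar>x\<bar> \<ge> real n + 1 \<longrightarrow> \<eta> n x = 0) \<and>
     (\<forall>x. \<bar>vderiv (\<eta> n) x\<bar> \<le> 2))"

definition special_integral_exists ::
    "(nat \<Rightarrow> real \<Rightarrow> real) \<Rightarrow> ((real \<Rightarrow> real) \<Rightarrow> real) \<Rightarrow> bool" where
  "special_integral_exists \<eta> q \<longleftrightarrow> convergent (\<lambda>n. q (\<eta> n))"

text \<open>Meaningful only if \<^const>\<open>special_integral_exists\<close> holds.\<close>

definition special_integral ::
    "(nat \<Rightarrow> real \<Rightarrow> real) \<Rightarrow> ((real \<Rightarrow> real) \<Rightarrow> real) \<Rightarrow> real" where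
  "special_integral \<eta> q = lim (\<lambda>n. q (\<eta> n))"

end

theory Submission
  imports Defs "HOL-Probability.Helly_Selection"
begin

text \<open>
  If \<open>q = r' + r\<^sup>2\<close> with \<open>r\<close> in \<open>L\<^sup>2\<close>, then \<open>(L\<^sub>q \<phi>, \<phi>)\<close> is the integral of \<open>|\<phi>' - r \<phi>|\<^sup>2\<close> and
  \<open>[q]\<close> is the integral of \<open>r\<^sup>2\<close>.

  Conversely, approximate \<open>q\<close> by smooth bounded potentials \<open>V\<^sub>n\<close> whose Schroedinger forms are strictly
  positive. The solution of \<open>u'' = V\<^sub>n u\<close> with \<open>u(-n) = 0\<close>, \<open>u'(-n) = 1\<close> has no further zero, so
  \<open>r\<^sub>n = u' / u\<close> solves the Riccati equation \<open>r\<^sub>n' + r\<^sub>n\<^sup>2 = V\<^sub>n\<close> on \<open>(-n, \<infinity>)\<close>. Testing with \<open>\<theta>\<^sup>2\<close> bounds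
  \<open>r\<^sub>n\<close> in \<open>L\<^sup>2\<close> locally, uniformly in \<open>n\<close>. Up to a linear function and a sequence that converges strongly
  in \<open>L\<^sup>2\<close>, \<open>- r\<^sub>n\<close> is nondecreasing because \<open>r\<^sub>n' - V\<^sub>n = - r\<^sub>n\<^sup>2 \<le> 0\<close>, so Helly's selection theorem gives a
  subsequence converging strongly in \<open>L\<^sup>2\<close> locally, and the limit \<open>r\<close> satisfies \<open>q = r' + r\<^sup>2\<close>. Since \<open>q\<close> is bounded
  on translates of a fixed test function, \<open>r\<close> is bounded in \<open>L\<^sup>2\<close> on unit intervals; hence the integral of
  \<open>r\<^sup>2\<close> over \<open>[-n, n]\<close> exceeds \<open>(q, \<eta>\<^sub>n)\<close> by at most a constant, and \<open>r\<close> is in \<open>L\<^sup>2\<close>.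
\<close>

section \<open>Smooth functions and test functions\<close>

lemma smooth_iff_vderiv:
  "smooth f \<longleftrightarrow> (\<forall>x. f differentiable (at x)) \<and> smooth (vderiv f)"
proof
  assume f: "smooth f"
  have "f differentiable (at x)" for x
    using f unfolding smooth_def by (metis funpow_0)
  moreover have "smooth (vderiv f)"
    using f unfolding smooth_def by (metis funpow_Suc_right comp_apply)
  ultimately show "(\<forall>x. f differentiable (at x)) \<and> smooth (vderiv f)" by blast
next
  assume f: "(\<forall>x. f differentiable (at x)) \<and> smooth (vderiv f)"
  show "smooth f"
    unfolding smooth_def
  proof (intro allI)
    fix n x
    show "(vderiv ^^ n) f differentiable (at x)"
      using f by (cases n) (simp_all add: smooth_def funpow_Suc_right del: funpow.simps(2))
  qed
qed

text \<open>Smoothness is the largest property that implies differentiability and passes to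
  \<open>vderiv\<close>. To prove it, one exhibits a class of differentiable functions that contains
  \<open>f\<close> and is closed under \<open>vderiv\<close>.\<close>

lemma smooth_coinduct:
  assumes "f \<in> S"
    and S: "\<And>g. g \<in> S \<Longrightarrow> (\<forall>x. g differentiable (at x)) \<and> vderiv g \<in> S"
  shows "smooth f"
  unfolding smooth_def
proof (intro allI)
  fix n x
  have "(vderiv ^^ n) f \<in> S"
    using \<open>f \<in> S\<close> S by (induction n) auto
  then show "(vderiv ^^ n) f differentiable (at x)"
    using S by blast
qed

lemma smooth_vderiv: "smooth f \<Longrightarrow> smooth (vderiv f)"
  by (simp add: smooth_iff_vderiv[of f])

lemma smooth_has_vderiv: "smooth f \<Longrightarrow> (f has_vector_derivative vderiv f x) (at x)"
  using smooth_iff_vderiv[of f] vector_derivative_works by blast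

lemma smooth_DERIV:
  fixes f :: "real \<Rightarrow> real"
  shows "smooth f \<Longrightarrow> (f has_real_derivative vderiv f x) (at x)"
  by (simp add: has_real_derivative_iff_has_vector_derivative smooth_has_vderiv)

lemma DERIV_vderiv:
  fixes f :: "real \<Rightarrow> real"
  shows "(f has_real_derivative D) (at x) \<Longrightarrow> vderiv f x = D"
  by (simp add: has_real_derivative_iff_has_vector_derivative vector_derivative_at)

lemma smooth_isCont: "smooth f \<Longrightarrow> isCont f x"
  by (metis differentiable_imp_continuous_within smooth_iff_vderiv)

lemma smooth_continuous_on: "smooth f \<Longrightarrow> continuous_on S f"
  by (simp add: continuous_at_imp_continuous_on smooth_isCont)

lemma smooth_borel_measurable: "smooth f \<Longrightarrow> f \<in> borel_measurable borel"
  by (simp add: borel_measurable_continuous_onI smooth_continuous_on)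

text \<open>By the sum and product rules this algebra is closed under differentiation once the
  derivatives of its generators lie in it. This replaces explicit formulas for higher
  derivatives.\<close>

inductive_set function_algebra :: "(real \<Rightarrow> real) set \<Rightarrow> (real \<Rightarrow> real) set"
  for A where
  gen: "f \<in> A \<Longrightarrow> f \<in> function_algebra A"
| add: "f \<in> function_algebra A \<Longrightarrow> g \<in> function_algebra A \<Longrightarrow> (\<lambda>x. f x + g x) \<in> function_algebra A"
| mult: "f \<in> function_algebra A \<Longrightarrow> g \<in> function_algebra A \<Longrightarrow> (\<lambda>x. f x * g x) \<in> function_algebra A"

text \<open>The hypothesis on generators propagates to all sums and products by induction, so the
  algebra itself is the class needed for \<open>smooth_coinduct\<close>.\<close>

lemma function_algebra_smooth:
  fixes f :: "real \<Rightarrow> real"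
  assumes A: "\<And>f. f \<in> A \<Longrightarrow>
      \<exists>f'\<in>function_algebra A. \<forall>x. (f has_real_derivative f' x) (at x)"
    and "f \<in> function_algebra A"
  shows "smooth f"
proof (rule smooth_coinduct[OF \<open>f \<in> function_algebra A\<close>])
  fix g assume "g \<in> function_algebra A"
  then have "\<exists>g'\<in>function_algebra A. \<forall>x. (g has_real_derivative g' x) (at x)"
  proof induction
    case (gen f)
    then show ?case by (rule A)
  next
    case (add f g)
    then obtain f' g' where "f' \<in> function_algebra A" "\<forall>x. (f has_real_derivative f' x) (at x)"
      "g' \<in> function_algebra A" "\<forall>x. (g has_real_derivative g' x) (at x)" by blast
    then show ?case
      by (intro bexI[of _ "\<lambda>x. f' x + g' x"])
         (auto intro!: DERIV_add function_algebra.add)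
  next
    case (mult f g)
    then obtain f' g' where "f' \<in> function_algebra A" "\<forall>x. (f has_real_derivative f' x) (at x)"
      "g' \<in> function_algebra A" "\<forall>x. (g has_real_derivative g' x) (at x)" by blast
    then show ?case using mult.hyps
      by (intro bexI[of _ "\<lambda>x. f' x * g x + g' x * f x"])
         (auto intro!: DERIV_mult function_algebra.add function_algebra.mult)
  qed
  then obtain g' where g': "g' \<in> function_algebra A" "\<forall>x. (g has_real_derivative g' x) (at x)"
    by blast
  then have "vderiv g = g'" by (auto intro!: DERIV_vderiv)
  then show "(\<forall>x. g differentiable (at x)) \<and> vderiv g \<in> function_algebra A"
    using g' real_differentiable_def by blast
qed

lemma function_algebra_smooth_gen:
  assumes "f \<in> function_algebra {f. smooth f}" shows "smooth f"
  by (rule function_algebra_smooth[OF _ assms])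
     (auto intro!: bexI[of _ "vderiv _"] smooth_DERIV function_algebra.gen smooth_vderiv)

lemma smooth_add:
  fixes f g :: "real \<Rightarrow> real"
  shows "smooth f \<Longrightarrow> smooth g \<Longrightarrow> smooth (\<lambda>x. f x + g x)"
  by (rule function_algebra_smooth_gen) (auto intro: function_algebra.intros)

lemma smooth_mult:
  fixes f g :: "real \<Rightarrow> real"
  shows "smooth f \<Longrightarrow> smooth g \<Longrightarrow> smooth (\<lambda>x. f x * g x)"
  by (rule function_algebra_smooth_gen) (auto intro: function_algebra.intros)

lemma smooth_const: "smooth (\<lambda>x. c :: real)"
  by (rule smooth_coinduct[of _ "range (\<lambda>c x. c)"]) auto

lemma smooth_minus:
  fixes f g :: "real \<Rightarrow> real"
  assumes "smooth f" "smooth g" shows "smooth (\<lambda>x. f x - g x)"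
  using smooth_add[OF assms(1) smooth_mult[OF smooth_const[of "-1"] assms(2)]] by simp

lemma smooth_affine: "smooth (\<lambda>x::real. c * x + d)"
proof -
  have "vderiv (\<lambda>x::real. c * x + d) = (\<lambda>x. c)"
    by (auto intro!: DERIV_vderiv derivative_eq_intros)
  then show ?thesis
    by (subst smooth_iff_vderiv) (simp add: smooth_const)
qed

text \<open>The chain rule leaves the set of compositions with \<open>u\<close>, because it produces
  the factor \<open>vderiv u\<close>. It stays inside the algebra generated by these compositions
  and the smooth functions.\<close>

lemma smooth_compose:
  fixes g u :: "real \<Rightarrow> real"
  assumes g: "smooth g" and u: "smooth u"
  shows "smooth (\<lambda>x. g (u x))"
proof -
  let ?A = "{f. smooth f} \<union> {\<lambda>x. g (u x) | g :: real \<Rightarrow> real. smooth g}"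
  show ?thesis
  proof (rule function_algebra_smooth[where A = ?A])
    show "(\<lambda>x. g (u x)) \<in> function_algebra ?A"
      using g by (intro function_algebra.gen) auto
    fix f assume "f \<in> ?A"
    then consider "smooth f" | g where "smooth g" "f = (\<lambda>x. g (u x))" by blast
    then show "\<exists>f'\<in>function_algebra ?A. \<forall>x. (f has_real_derivative f' x) (at x)"
    proof cases
      case 1
      then show ?thesis
        by (intro bexI[of _ "vderiv f"]) (auto intro!: smooth_DERIV function_algebra.gen smooth_vderiv)
    next
      case (2 g)
      have "\<forall>x. (f has_real_derivative vderiv g (u x) * vderiv u x) (at x)"
        unfolding 2(2) using DERIV_chain2 smooth_DERIV 2(1) u by blast
      moreover have "(\<lambda>x. vderiv g (u x) * vderiv u x) \<in> function_algebra ?A"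
        using smooth_vderiv[OF 2(1)] smooth_vderiv[OF u]
        by (intro function_algebra.mult function_algebra.gen) auto
      ultimately show ?thesis by (rule bexI)
    qed
  qed
qed

text \<open>Applied to \<open>Re\<close>, \<open>Im\<close> and \<open>of_real\<close>, this passes
  between complex and real test functions.\<close>

lemma smooth_bounded_linear:
  assumes L: "bounded_linear L" and "smooth f"
  shows "smooth (\<lambda>x. L (f x))" "vderiv (\<lambda>x. L (f x)) x = L (vderiv f x)"
proof -
  have D: "((\<lambda>x. L (f x)) has_vector_derivative L (vderiv f x)) (at x)" if "smooth f" for f x
    using bounded_linear.has_vector_derivative[OF L smooth_has_vderiv[OF that]] .
  show "vderiv (\<lambda>x. L (f x)) x = L (vderiv f x)"
    using D[OF \<open>smooth f\<close>] by (rule vector_derivative_at)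
  show "smooth (\<lambda>x. L (f x))"
  proof (rule smooth_coinduct[of _ "{\<lambda>x. L (f x) | f. smooth f}"])
    fix g assume "g \<in> {\<lambda>x. L (f x) | f. smooth f}"
    then obtain f where f: "smooth f" "g = (\<lambda>x. L (f x))" by blast
    have "vderiv g = (\<lambda>x. L (vderiv f x))"
      using D[OF f(1)] unfolding f(2) by (auto intro!: vector_derivative_at)
    moreover have "g differentiable (at x)" for x
      unfolding f(2) by (rule differentiableI_vector[OF D[OF f(1)]])
    ultimately show "(\<forall>x. g differentiable (at x)) \<and> vderiv g \<in> {\<lambda>x. L (f x) | f. smooth f}"
      using smooth_vderiv[OF f(1)] by auto
  qed (use \<open>smooth f\<close> in blast)
qed

section \<open>Test functions and their algebra\<close>

lemma test_functions_iff:
  "\<phi> \<in> test_functions \<longleftrightarrow> smooth \<phi> \<and> (\<exists>M. \<forall>x. \<bar>x\<bar> > M \<longrightarrow> \<phi> x = 0)"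
proof -
  have "compact (closure {x. \<phi> x \<noteq> 0}) \<longleftrightarrow> (\<exists>M. \<forall>x. \<bar>x\<bar> > M \<longrightarrow> \<phi> x = 0)"
    unfolding compact_closure bounded_iff by (auto simp: not_less[symmetric])
  then show ?thesis by (auto simp: test_functions_def)
qed

lemma vderiv_zero_outside:
  assumes "\<And>x. \<bar>x\<bar> > M \<Longrightarrow> \<phi> x = 0" "\<bar>x\<bar> > M"
  shows "vderiv \<phi> x = 0"
proof -
  have "open {x::real. \<bar>x\<bar> > M}" by (intro open_Collect_less continuous_intros)
  then have "(\<phi> has_vector_derivative 0) (at x)"
    by (rule has_vector_derivative_transform_within_open[OF has_vector_derivative_const[of 0]])
       (use assms in auto)
  then show ?thesis by (rule vector_derivative_at)
qed

lemma test_functionE: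
  assumes "\<phi> \<in> test_functions"
  obtains M where "smooth \<phi>" "M > 0" "\<And>x. \<bar>x\<bar> \<ge> M \<Longrightarrow> \<phi> x = 0" "\<And>x. \<bar>x\<bar> \<ge> M \<Longrightarrow> vderiv \<phi> x = 0"
proof -
  obtain M where M: "smooth \<phi>" "\<And>x. \<bar>x\<bar> > M \<Longrightarrow> \<phi> x = 0"
    using assms test_functions_iff by blast
  \<comment> \<open>Enlarging the radius makes it positive and lets the function and its derivative
    vanish already on the sphere.\<close>
  then show ?thesis using that[of "\<bar>M\<bar> + 1"] vderiv_zero_outside[of M \<phi>] by force
qed

lemma test_functionI: "smooth \<phi> \<Longrightarrow> (\<And>x. \<bar>x\<bar> > M \<Longrightarrow> \<phi> x = 0) \<Longrightarrow> \<phi> \<in> test_functions"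
  using test_functions_iff by blast

lemma test_smooth: "\<phi> \<in> test_functions \<Longrightarrow> smooth \<phi>"
  by (simp add: test_functions_def)

lemma test_vderiv: "\<phi> \<in> test_functions \<Longrightarrow> vderiv \<phi> \<in> test_functions"
  by (erule test_functionE) (auto intro!: test_functionI smooth_vderiv less_imp_le)

lemma test_mult:
  fixes \<phi> :: "real \<Rightarrow> real"
  assumes "\<phi> \<in> test_functions" "smooth g" shows "(\<lambda>x. g x * \<phi> x) \<in> test_functions"
  using assms by (auto simp: test_functions_iff smooth_mult)

lemma test_scale:
  fixes \<phi> :: "real \<Rightarrow> real"
  shows "\<phi> \<in> test_functions \<Longrightarrow> (\<lambda>x. c * \<phi> x) \<in> test_functions"
  by (rule test_mult[OF _ smooth_const])

lemma test_add:
  fixes \<phi> :: "real \<Rightarrow> real"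
  assumes "\<phi> \<in> test_functions" "\<psi> \<in> test_functions"
  shows "(\<lambda>x. \<phi> x + \<psi> x) \<in> test_functions"
proof -
  obtain M N where "\<And>x. \<bar>x\<bar> \<ge> M \<Longrightarrow> \<phi> x = 0" "\<And>x. \<bar>x\<bar> \<ge> N \<Longrightarrow> \<psi> x = 0"
    using test_functionE[OF assms(1)] test_functionE[OF assms(2)] by metis
  then show ?thesis
    using assms by (intro test_functionI[of _ "max M N"]) (auto simp: smooth_add test_smooth)
qed

lemma test_power2:
  fixes \<phi> :: "real \<Rightarrow> real"
  shows "\<phi> \<in> test_functions \<Longrightarrow> (\<lambda>x. (\<phi> x)\<^sup>2) \<in> test_functions"
  unfolding power2_eq_square by (simp add: test_mult test_smooth)

lemma vderiv_add:
  fixes \<phi> :: "real \<Rightarrow> real"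
  shows "smooth \<phi> \<Longrightarrow> smooth \<psi> \<Longrightarrow> vderiv (\<lambda>x. \<phi> x + \<psi> x) x = vderiv \<phi> x + vderiv \<psi> x"
  by (intro DERIV_vderiv DERIV_add smooth_DERIV)

lemma vderiv_scale:
  fixes \<phi> :: "real \<Rightarrow> real"
  shows "smooth \<phi> \<Longrightarrow> vderiv (\<lambda>x. c * \<phi> x) x = c * vderiv \<phi> x"
  by (intro DERIV_vderiv DERIV_cmult smooth_DERIV)

lemma vderiv_power2:
  fixes \<phi> :: "real \<Rightarrow> real"
  assumes "smooth \<phi>" shows "vderiv (\<lambda>x. (\<phi> x)\<^sup>2) x = 2 * \<phi> x * vderiv \<phi> x"
  using smooth_DERIV[OF assms] by (intro DERIV_vderiv) (auto intro!: derivative_eq_intros)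

section \<open>Integrals of compactly supported functions\<close>

lemma test_integrable:
  fixes \<phi> :: "real \<Rightarrow> real"
  assumes "\<phi> \<in> test_functions" shows "integrable lborel \<phi>"
proof -
  obtain M where M: "smooth \<phi>" "\<And>x. \<bar>x\<bar> \<ge> M \<Longrightarrow> \<phi> x = 0"
    using assms test_functionE by metis
  have "set_integrable lborel {-M..M} \<phi>"
    by (intro borel_integrable_atLeastAtMost' smooth_continuous_on M)
  moreover have "(\<lambda>x. indicator {-M..M} x *\<^sub>R \<phi> x) = \<phi>"
  proof
    fix x show "indicator {-M..M} x *\<^sub>R \<phi> x = \<phi> x"
      using M(2)[of x] by (cases "x \<in> {-M..M}") auto
  qed
  ultimately show ?thesis by (simp add: set_integrable_def)
qed

text \<open>Differentiability of \<open>F\<close> is asked only on \<open>{a..b}\<close>, so that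
  \<open>F\<close> may be a Riccati solution times a cutoff, where the solution is controlled on one
  interval only.\<close>

lemma has_bochner_integral_deriv_zero:
  fixes F f :: "real \<Rightarrow> real"
  assumes "a \<le> b"
    and "\<And>x. a \<le> x \<Longrightarrow> x \<le> b \<Longrightarrow> (F has_real_derivative f x) (at x)"
    and "\<And>x. a \<le> x \<Longrightarrow> x \<le> b \<Longrightarrow> isCont f x"
    and "\<And>x. x < a \<or> x > b \<Longrightarrow> f x = 0" and "F a = F b"
  shows "has_bochner_integral lborel f 0"
proof -
  have "has_bochner_integral lborel (\<lambda>x. f x * indicator {a..b} x) (F b - F a)"
    using assms by (intro has_bochner_integral_FTC_Icc_real) auto
  moreover have "(\<lambda>x. f x * indicator {a..b} x) = f"
    using assms(4) by (force simp: indicator_def)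
  ultimately show ?thesis using assms(5) by simp
qed

lemma test_integral_vderiv:
  fixes \<phi> :: "real \<Rightarrow> real"
  assumes "\<phi> \<in> test_functions" shows "(LINT x|lborel. vderiv \<phi> x) = 0"
proof -
  obtain M where M: "smooth \<phi>" "M > 0" "\<And>x. \<bar>x\<bar> \<ge> M \<Longrightarrow> \<phi> x = 0" "\<And>x. \<bar>x\<bar> \<ge> M \<Longrightarrow> vderiv \<phi> x = 0"
    using test_functionE[OF assms] by metis
  have "has_bochner_integral lborel (vderiv \<phi>) 0"
    by (rule has_bochner_integral_deriv_zero[of "-M" M \<phi>])
       (use M in \<open>auto simp: smooth_DERIV smooth_isCont smooth_vderiv\<close>)
  then show ?thesis by (simp add: has_bochner_integral_iff)
qed

section \<open>Linear second order equations\<close>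

text \<open>The claimed bound minus \<open>F\<close> vanishes at \<open>a\<close> and has
  nonnegative derivative to the right of \<open>a\<close>. Iterated, the divisor
  \<open>Suc k\<close> builds up the factorial in the Picard estimates.\<close>

lemma deriv_power_bound_right:
  fixes F f :: "real \<Rightarrow> real"
  assumes D: "\<And>t. (F has_real_derivative f t) (at t)" and "F a = 0"
    and le: "\<And>t. a \<le> t \<Longrightarrow> f t \<le> C * (t - a) ^ k" and "a \<le> x"
  shows "F x \<le> C * (x - a) ^ Suc k / Suc k"
proof -
  let ?G = "\<lambda>t. C * (t - a) ^ Suc k / Suc k - F t"
  have DG: "(?G has_real_derivative C * (t - a) ^ k - f t) (at t)" for t
  proof -
    have "((\<lambda>t. (t - a) ^ Suc k) has_real_derivative Suc k * (t - a) ^ k) (at t)"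
      by (rule derivative_eq_intros refl | simp)+
    from DERIV_cdivide[OF DERIV_cmult[OF this, of C], of "Suc k"]
    have "((\<lambda>t. C * (t - a) ^ Suc k / Suc k) has_real_derivative C * (t - a) ^ k) (at t)"
      by simp
    then show ?thesis using D by (rule DERIV_diff)
  qed
  have "?G a \<le> ?G x"
    using \<open>a \<le> x\<close> DG le by (intro DERIV_nonneg_imp_nondecreasing[of a x ?G]) force+
  then show ?thesis using \<open>F a = 0\<close> by simp
qed

lemma deriv_power_bound:
  fixes F f :: "real \<Rightarrow> real"
  assumes D: "\<And>t. (F has_real_derivative f t) (at t)" and Fa: "F a = 0"
    and le: "\<And>t. \<bar>f t\<bar> \<le> C * \<bar>t - a\<bar> ^ k"
  shows "\<bar>F x\<bar> \<le> C * \<bar>x - a\<bar> ^ Suc k / Suc k"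
proof -
  have right: "\<bar>F x\<bar> \<le> C * (x - a) ^ Suc k / Suc k"
    if D: "\<And>t. (F has_real_derivative f t) (at t)" and Fa: "F a = 0"
    and le: "\<And>t. \<bar>f t\<bar> \<le> C * \<bar>t - a\<bar> ^ k" and "a \<le> x" for F f :: "real \<Rightarrow> real" and x
  proof -
    have "\<bar>f t\<bar> \<le> C * (t - a) ^ k" if "a \<le> t" for t
      using le[of t] that by simp
    then have "F x \<le> C * (x - a) ^ Suc k / Suc k" "- F x \<le> C * (x - a) ^ Suc k / Suc k"
      using deriv_power_bound_right[OF D Fa _ \<open>a \<le> x\<close>, of C k]
        deriv_power_bound_right[OF DERIV_minus[OF D], of a C k x] Fa \<open>a \<le> x\<close> by (force simp: abs_le_iff)+
    then show ?thesis by linarith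
  qed
  show ?thesis
  proof (cases "a \<le> x")
    case True
    then show ?thesis using right[OF D Fa le True] by simp
  next
    case False
    \<comment> \<open>Reflection at \<open>a\<close> reduces points to the left of \<open>a\<close>
      to the one-sided case.\<close>
    have "((\<lambda>t. F (2 * a - t)) has_real_derivative - f (2 * a - t)) (at t)" for t
      using DERIV_chain2[OF D, of "\<lambda>t. 2 * a - t" "-1" t UNIV]
        DERIV_diff[OF DERIV_const[of "2 * a"] DERIV_ident[of "at t"]]
      by simp
    moreover have "\<bar>- f (2 * a - t)\<bar> \<le> C * \<bar>t - a\<bar> ^ k" for t
      using le[of "2 * a - t"] by (simp add: abs_minus_commute)
    ultimately have "\<bar>F (2 * a - (2 * a - x))\<bar> \<le> C * ((2 * a - x) - a) ^ Suc k / Suc k"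
      using Fa False by (intro right) auto
    moreover have "(2 * a - x) - a = \<bar>x - a\<bar>" using False by simp
    ultimately show ?thesis by (simp only: diff_diff_eq2 add_diff_cancel_left')
  qed
qed

lemma antiderivative_exists:
  fixes f :: "real \<Rightarrow> real"
  assumes "\<And>x. isCont f x"
  shows "\<exists>F. F a = 0 \<and> (\<forall>x. (F has_real_derivative f x) (at x))"
proof -
  obtain F where "\<And>x. (F has_vector_derivative f x) (at x)"
    using einterval_antiderivative[of "-\<infinity>" \<infinity> f] assms by auto
  then have "\<And>x. ((\<lambda>x. F x - F a) has_real_derivative f x) (at x)"
    by (auto intro!: derivative_eq_intros simp: has_real_derivative_iff_has_vector_derivative)
  then show ?thesis by (intro exI[of _ "\<lambda>x. F x - F a"]) auto
qed

text \<open>The Weierstrass test is needed for the differentiated series only: all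
  \<open>f j\<close> vanish at \<open>a\<close>, so the series itself converges there, and locally
  uniform convergence of the derivatives does the rest.\<close>

lemma has_real_derivative_suminf:
  fixes f d :: "nat \<Rightarrow> real \<Rightarrow> real"
  assumes D: "\<And>j x. (f j has_real_derivative d j x) (at x)" and fa: "\<And>j. f j a = 0"
    and bd: "\<And>R j x. \<bar>x - a\<bar> \<le> R \<Longrightarrow> \<bar>d j x\<bar> \<le> m R j" and m: "\<And>R. summable (m R)"
  shows "((\<lambda>x. \<Sum>j. f j x) has_real_derivative (\<Sum>j. d j x)) (at x)"
proof -
  define R where "R = \<bar>x - a\<bar> + 1"
  let ?S = "{a - R..a + R}"
  have "uniform_limit ?S (\<lambda>n x. \<Sum>i<n. d i x) (\<lambda>x. \<Sum>i. d i x) sequentially"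
  proof (rule Weierstrass_m_test[OF _ m[of R]])
    fix n y assume "y \<in> ?S"
    then have "\<bar>y - a\<bar> \<le> R" by (simp add: abs_le_iff)
    then show "norm (d n y) \<le> m R n" using bd by simp
  qed
  then have unif: "uniformly_convergent_on ?S (\<lambda>n x. \<Sum>i<n. d i x)"
    by (auto simp: uniformly_convergent_on_def)
  have mem: "a \<in> ?S" "x \<in> interior ?S"
    by (auto simp: R_def)
  show ?thesis
    by (rule has_field_derivative_series'(2)[of ?S f d a x])
      (use unif mem in \<open>auto intro: has_field_derivative_at_within D simp: fa\<close>)
qed

text \<open>The solution is the Picard series: \<open>z 0 = 1\<close>, and \<open>z (Suc k)\<close> is the primitive of \<open>z k\<close>
  for even \<open>k\<close> and of \<open>V * z k\<close> for odd \<open>k\<close>.\<close>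

lemma linear_ode_exists:
  fixes V :: "real \<Rightarrow> real"
  assumes V: "\<And>x. isCont V x" and VM: "\<And>x. \<bar>V x\<bar> \<le> M"
  shows "\<exists>u v. u a = 0 \<and> v a = 1 \<and> (\<forall>x. (u has_real_derivative v x) (at x)) \<and>
    (\<forall>x. (v has_real_derivative V x * u x) (at x))"
proof -
  \<comment> \<open>The maximum bounds both weights of the recursion, the constant \<open>1\<close>
    and \<open>V\<close>.\<close>
  define N where "N = max 1 M"
  have N: "N \<ge> 1" "\<And>x. \<bar>V x\<bar> \<le> N" using VM by (auto simp: N_def le_max_iff_disj)
  define w where "w k = (if even k then (\<lambda>x. 1) else V)" for k :: nat
  have w: "isCont (w k) x" "\<bar>w k x\<bar> \<le> N" for k x
    using V N by (auto simp: w_def)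
  define prim where "prim f = (SOME F. F a = 0 \<and> (\<forall>x. (F has_real_derivative f x) (at x)))"
    for f :: "real \<Rightarrow> real"
  have prim: "prim f a = 0" "(prim f has_real_derivative f x) (at x)" if "\<And>x. isCont f x" for f x
    using someI_ex[OF antiderivative_exists[of f a]] that unfolding prim_def by blast+
  define z where "z = rec_nat (\<lambda>x. 1) (\<lambda>k f. prim (\<lambda>x. w k x * f x))"
  have z0: "z 0 = (\<lambda>x. 1)" and zS: "z (Suc k) = prim (\<lambda>x. w k x * z k x)" for k
    by (simp_all add: z_def)
  have zC: "isCont (z k) x" for k x
  proof (induction k arbitrary: x)
    case (Suc k)
    have "(z (Suc k) has_real_derivative w k x * z k x) (at x)"
      unfolding zS by (rule prim) (intro continuous_intros w Suc)
    then show ?case by (rule DERIV_isCont)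
  qed (simp add: z0)
  have zD: "z (Suc k) a = 0" "(z (Suc k) has_real_derivative w k x * z k x) (at x)" for k x
    unfolding zS by (rule prim; intro continuous_intros w zC)+
  have zB: "\<bar>z k x\<bar> \<le> N ^ k / fact k * \<bar>x - a\<bar> ^ k" for k x
  proof (induction k arbitrary: x)
    case (Suc k)
    have "\<bar>w k t * z k t\<bar> \<le> N * (N ^ k / fact k * \<bar>t - a\<bar> ^ k)" for t
      unfolding abs_mult using w Suc N by (intro mult_mono) auto
    then have "\<bar>w k t * z k t\<bar> \<le> (N * N ^ k / fact k) * \<bar>t - a\<bar> ^ k" for t
      by (simp add: mult.assoc)
    from deriv_power_bound[OF zD(2) zD(1) this]
    show ?case by (simp add: field_simps)
  qed (simp add: z0)
  \<comment> \<open>These are the terms of the exponential series at \<open>N * R\<close>, a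
    summable majorant on the interval of radius \<open>R\<close> around \<open>a\<close>.\<close>
  define m where "m R k = (N * R) ^ k /\<^sub>R fact k" for R :: real and k
  have zm: "\<bar>z k x\<bar> \<le> m R k" if "\<bar>x - a\<bar> \<le> R" for R k x
  proof -
    have "\<bar>z k x\<bar> \<le> N ^ k / fact k * R ^ k"
      using that N by (intro order.trans[OF zB] mult_left_mono power_mono) auto
    then show ?thesis by (simp add: m_def field_simps power_mult_distrib)
  qed
  have m: "summable (\<lambda>j. m R (2 * j))" "summable (\<lambda>j. m R (Suc (2 * j)))" for R
  proof -
    have "summable (\<lambda>k. norm (m R k))"
      unfolding m_def by (rule summable_norm_exp)
    then have "summable ((\<lambda>k. norm (m R k)) \<circ> (\<lambda>j. 2 * j))"
      "summable ((\<lambda>k. norm (m R k)) \<circ> (\<lambda>j. Suc (2 * j)))"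
      by (intro summable_reindex; auto simp: inj_on_def)+
    then show "summable (\<lambda>j. m R (2 * j))" "summable (\<lambda>j. m R (Suc (2 * j)))"
      unfolding comp_def by (auto intro: summable_norm_cancel)
  qed
  have zsum: "summable (\<lambda>j. z (2 * j) x)" "summable (\<lambda>j. z (Suc (2 * j)) x)" for x
    using m[of "\<bar>x - a\<bar>"] zm[of x "\<bar>x - a\<bar>"]
    by (auto intro: summable_comparison_test')
  \<comment> \<open>The odd iterates sum to \<open>u\<close> and the even ones to \<open>v\<close>,
    so termwise differentiation gives \<open>u' = v\<close> and \<open>v' = V u\<close>. The term
    \<open>z 0 = 1\<close> stands apart in \<open>v\<close> because it does not vanish at
    \<open>a\<close>.\<close>
  define u where "u x = (\<Sum>j. z (Suc (2 * j)) x)" for x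
  define v where "v x = 1 + (\<Sum>j. z (Suc (Suc (2 * j))) x)" for x
  have v_eq: "(\<Sum>j. z (2 * j) x) = v x" for x
    using suminf_split_head[OF zsum(1)[of x]] by (simp add: v_def z0)
  have "(u has_real_derivative (\<Sum>j. z (2 * j) x)) (at x)" for x
    unfolding u_def using zD(2)[of "2 * j" for j] zD(1) zm m
    by (intro has_real_derivative_suminf[where a = a and m = "\<lambda>R j. m R (2 * j)"])
       (auto simp: w_def)
  then have "(u has_real_derivative v x) (at x)" for x by (simp add: v_eq)
  moreover have "(v has_real_derivative V x * u x) (at x)" for x
  proof -
    have "((\<lambda>x. \<Sum>j. z (Suc (Suc (2 * j))) x) has_real_derivative
       (\<Sum>j. V x * z (Suc (2 * j)) x)) (at x)"
    proof (rule has_real_derivative_suminf[where a = a and m = "\<lambda>R j. N * m R (Suc (2 * j))"])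
      show "(z (Suc (Suc (2 * j))) has_real_derivative V x * z (Suc (2 * j)) x) (at x)" for j x
        using zD(2)[of "Suc (2 * j)" x] by (simp add: w_def)
      show "\<bar>V x * z (Suc (2 * j)) x\<bar> \<le> N * m R (Suc (2 * j))" if "\<bar>x - a\<bar> \<le> R" for R j x
        unfolding abs_mult using that N zm by (intro mult_mono) auto
      show "summable (\<lambda>j. N * m R (Suc (2 * j)))" for R
        by (intro summable_mult m)
    qed (rule zD)
    then have "((\<lambda>x. \<Sum>j. z (Suc (Suc (2 * j))) x) has_real_derivative V x * u x) (at x)"
      by (simp add: suminf_mult zsum u_def)
    then show ?thesis unfolding v_def
      by (auto intro!: derivative_eq_intros)
  qed
  moreover have "u a = 0" "v a = 1"
    by (simp_all add: u_def v_def zD)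
  ultimately show ?thesis by blast
qed

text \<open>Bootstrapping: the derivatives \<open>v\<close> and \<open>V u\<close> of the generators
  \<open>u\<close> and \<open>v\<close> lie again in the algebra generated by \<open>u\<close>,
  \<open>v\<close> and all smooth functions.\<close>

lemma smooth_ode_solution:
  fixes u v V :: "real \<Rightarrow> real"
  assumes "smooth V" and u: "\<And>x. (u has_real_derivative v x) (at x)"
    and v: "\<And>x. (v has_real_derivative V x * u x) (at x)"
  shows "smooth u" "smooth v"
proof -
  let ?A = "{u, v} \<union> {f. smooth f}"
  have "\<exists>f'\<in>function_algebra ?A. \<forall>x. (f has_real_derivative f' x) (at x)" if f: "f \<in> ?A" for f
  proof -
    consider "f = u" | "f = v" | "smooth f" using f by blast
    then show ?thesis
    proof cases
      case 1
      then show ?thesis using u by (intro bexI[of _ v]) (auto intro: function_algebra.gen)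
    next
      case 2
      then show ?thesis using v \<open>smooth V\<close>
        by (intro bexI[of _ "\<lambda>x. V x * u x"]) (auto intro: function_algebra.intros)
    next
      case 3
      then show ?thesis
        by (intro bexI[of _ "vderiv f"]) (auto intro!: smooth_DERIV function_algebra.gen smooth_vderiv)
    qed
  qed
  from function_algebra_smooth[of ?A, OF this] show "smooth u" "smooth v"
    by (auto intro: function_algebra.gen)
qed

text \<open>Where \<bar>u\<bar> < e both branches are zero. Since \<open>u\<close> vanishes at
  \<open>a\<close> and \<open>b\<close>, this covers a neighbourhood of each endpoint, so cutting
  off outside the interval creates no corner.\<close>

lemma cut_composition:
  fixes u v g :: "real \<Rightarrow> real"
  assumes u: "smooth u" and zero: "u a = 0" "u b = 0"
    and g: "smooth g" and e: "e > 0" "\<And>s. \<bar>s\<bar> \<le> e \<Longrightarrow> g s = 0"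
  shows "smooth (\<lambda>x. if a \<le> x \<and> x \<le> b then g (u x) else 0)" (is "smooth (?cut g)")
    and "((\<lambda>x. if a \<le> x \<and> x \<le> b then g (u x) else 0) has_real_derivative
      (if a \<le> x \<and> x \<le> b then vderiv g (u x) * vderiv u x else 0)) (at x)"
proof -
  let ?G = "{g. smooth g \<and> (\<exists>e>0. \<forall>s. \<bar>s\<bar> \<le> e \<longrightarrow> g s = 0)}"
  \<comment> \<open>The derivative of \<open>g\<close> inherits the vanishing near \<open>0\<close>
    only for strict inequality; hence the radius \<open>e / 2\<close> when \<open>vderiv g\<close>
    takes the place of \<open>g\<close> below.\<close>
  have g': "vderiv g s = 0" if "\<bar>s\<bar> < e" "\<And>s. \<bar>s\<bar> \<le> e \<Longrightarrow> g s = 0" for g :: "real \<Rightarrow> real" and e s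
  proof (rule DERIV_vderiv)
    have "open {s::real. \<bar>s\<bar> < e}" by (intro open_Collect_less continuous_intros)
    from has_field_derivative_transform_within_open[OF DERIV_const[of 0] this]
    show "(g has_real_derivative 0) (at s)" using that by auto
  qed
  have D: "(?cut g has_real_derivative
      (if a \<le> x \<and> x \<le> b then vderiv g (u x) * vderiv u x else 0)) (at x)"
    if g: "smooth g" and e: "e > 0" "\<And>s. \<bar>s\<bar> \<le> e \<Longrightarrow> g s = 0" for g e x
  proof (cases "\<bar>u x\<bar> < e")
    case True
    have "open {x. \<bar>u x\<bar> < e}"
      by (intro open_Collect_less continuous_intros smooth_continuous_on u)
    from has_field_derivative_transform_within_open[OF DERIV_const[of 0] this, of x "?cut g"]
    have "(?cut g has_real_derivative 0) (at x)" using True e by auto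
    then show ?thesis using g'[OF True e(2)] by simp
  next
    case False
    then have ne: "x \<noteq> a" "x \<noteq> b" using zero e by auto
    show ?thesis
    proof (cases "a < x \<and> x < b")
      case True
      have "((\<lambda>x. g (u x)) has_real_derivative vderiv g (u x) * vderiv u x) (at x)"
        using DERIV_chain2 smooth_DERIV g u by blast
      from has_field_derivative_transform_within_open[OF this, of "{a<..<b}" "?cut g"]
      show ?thesis using True by auto
    next
      case False
      have "open ({..<a} \<union> {b<..})" by auto
      from has_field_derivative_transform_within_open[OF DERIV_const[of 0] this, of x "?cut g"]
      have "(?cut g has_real_derivative 0) (at x)" using False ne by fastforce
      then show ?thesis using False ne by auto
    qed
  qed
  show "(?cut g has_real_derivative
      (if a \<le> x \<and> x \<le> b then vderiv g (u x) * vderiv u x else 0)) (at x)"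
    by (rule D[OF g e])
  \<comment> \<open>The derivative of a cut composition is the cut composition of
    \<open>vderiv g\<close> times \<open>vderiv u\<close>, an element of the algebra generated by
    this set.\<close>
  let ?A = "?cut ` ?G \<union> {f. smooth f}"
  show "smooth (?cut g)"
  proof (rule function_algebra_smooth[where A = ?A])
    show "?cut g \<in> function_algebra ?A"
      using g e by (intro function_algebra.gen) blast
    fix f assume "f \<in> ?A"
    then consider "smooth f" | g e where "smooth g" "e > 0" "\<And>s. \<bar>s\<bar> \<le> e \<Longrightarrow> g s = 0" "f = ?cut g"
      by blast
    then show "\<exists>f'\<in>function_algebra ?A. \<forall>x. (f has_real_derivative f' x) (at x)"
    proof cases
      case 1
      then show ?thesis
        by (intro bexI[of _ "vderiv f"]) (auto intro!: smooth_DERIV function_algebra.gen smooth_vderiv)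
    next
      case (2 g e)
      have "vderiv g \<in> ?G"
        using 2 g'[of _ e g] by (auto intro!: smooth_vderiv exI[of _ "e / 2"])
      then have "?cut (vderiv g) \<in> ?A" by (intro UnI1 imageI)
      moreover have "vderiv u \<in> ?A" using smooth_vderiv[OF u] by blast
      ultimately have "?cut (vderiv g) \<in> function_algebra ?A" "vderiv u \<in> function_algebra ?A"
        by (blast intro: function_algebra.gen)+
      then have "(\<lambda>x. ?cut (vderiv g) x * vderiv u x) \<in> function_algebra ?A"
        by (rule function_algebra.mult)
      moreover have "(f has_real_derivative ?cut (vderiv g) x * vderiv u x) (at x)" for x
      proof -
        have "?cut (vderiv g) x * vderiv u x =
            (if a \<le> x \<and> x \<le> b then vderiv g (u x) * vderiv u x else 0)"
          by simp
        then show ?thesis using D[OF 2(1,2,3), of x] unfolding 2(4) by (simp only:)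
      qed
      ultimately show ?thesis by (intro bexI allI)
    qed
  qed
qed

section \<open>Positivity and the Riccati equation\<close>

lemma smooth_cutoff_bounded:
  fixes g :: "real \<Rightarrow> real"
  assumes g: "continuous_on UNIV g" and far: "\<And>s. \<bar>s\<bar> \<ge> R \<Longrightarrow> g s = c"
  shows "\<exists>L. \<forall>s. \<bar>g s\<bar> \<le> L"
proof -
  have "bounded (g ` {-R..R})"
    by (intro compact_imp_bounded compact_continuous_image continuous_on_subset[OF g]) auto
  then obtain L where L: "\<And>s. s \<in> {-R..R} \<Longrightarrow> \<bar>g s\<bar> \<le> L"
    unfolding bounded_iff by (metis image_eqI real_norm_def)
  have "\<bar>g s\<bar> \<le> max L \<bar>c\<bar>" for s
  proof (cases "\<bar>s\<bar> \<ge> R")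
    case False
    then have "\<bar>g s\<bar> \<le> L" by (intro L) auto
    then show ?thesis by simp
  qed (simp add: far)
  then show ?thesis by blast
qed

text \<open>If the solution had a zero \<open>b > a\<close>, it would make the quadratic form vanish on \<open>[a, b]\<close>.
  Composing with functions that vanish near \<open>0\<close> turns it into smooth test functions.\<close>

lemma ode_solution_positive:
  fixes u v V :: "real \<Rightarrow> real"
  assumes V: "smooth V" and VM: "\<And>x. \<bar>V x\<bar> \<le> M" and c: "c > 0"
    and form: "\<And>\<psi>. \<psi> \<in> test_functions \<Longrightarrow>
      0 \<le> (LINT x|lborel. (vderiv \<psi> x)\<^sup>2 + (V x - c) * (\<psi> x)\<^sup>2)"
    and \<theta>: "smooth \<theta>" "\<And>s. \<bar>s\<bar> \<le> 1 \<Longrightarrow> \<theta> s = 1" "\<And>s. \<bar>s\<bar> \<ge> 2 \<Longrightarrow> \<theta> s = (0::real)"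
    and u: "\<And>x. (u has_real_derivative v x) (at x)"
    and v: "\<And>x. (v has_real_derivative V x * u x) (at x)"
    and a: "u a = 0" "v a = 1" and "a < x0"
  shows "u x0 > 0"
proof (rule ccontr)
  assume neg: "\<not> u x0 > 0"
  have smooth: "smooth u" "smooth v"
    using smooth_ode_solution[OF V u v] .
  have vderiv_u: "vderiv u x = v x" for x
    using u by (auto intro: DERIV_vderiv)
  obtain d where d: "d > 0" "\<And>h. 0 < h \<Longrightarrow> h < d \<Longrightarrow> 0 < u (a + h)"
    using DERIV_pos_inc_right[OF u[of a]] a by auto
  have xd: "x0 \<ge> a + d"
    using d(2)[of "x0 - a"] neg \<open>a < x0\<close> by force
  \<comment> \<open>Starting at \<open>a + d / 2\<close> keeps the zero at \<open>a\<close> out of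
    the set. Its infimum \<open>b\<close> is then the first zero of \<open>u\<close> to the right of
    \<open>a\<close>.\<close>
  define Z where "Z = {x \<in> {a + d / 2..x0}. u x \<le> 0}"
  define b where "b = Inf Z"
  have "closed Z"
    unfolding Z_def
    by (intro continuous_closed_preimage_constant continuous_on_closed_Collect_le
        smooth_continuous_on smooth continuous_on_const closed_atLeastAtMost)
  moreover have "x0 \<in> Z" using xd d neg by (auto simp: Z_def)
  moreover have bdd: "bdd_below Z" unfolding Z_def by (intro bdd_belowI[of _ "a + d / 2"]) auto
  ultimately have "b \<in> Z" unfolding b_def by (intro closed_contains_Inf) auto
  then have b: "a + d / 2 \<le> b" "b \<le> x0" "u b \<le> 0" by (auto simp: Z_def)
  have bmin: "b \<le> x" if "x \<in> Z" for x
    unfolding b_def using that bdd by (rule cInf_lower)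
  have "a < b" using b d by linarith
  have pos: "u x > 0" if "a < x" "x < b" for x
  proof (cases "x < a + d / 2")
    case True
    then show ?thesis using d(2)[of "x - a"] that by simp
  next
    case False
    then have "x \<notin> Z" using bmin that by force
    then show ?thesis using False that b by (auto simp: Z_def)
  qed
  have "u b = 0"
  proof -
    have "\<exists>x\<ge>a + d / 2. x \<le> b \<and> u x = 0"
      using b d smooth by (intro IVT2) (auto intro: smooth_isCont less_imp_le)
    then obtain x where "a + d / 2 \<le> x" "x \<le> b" "u x = 0" by blast
    moreover from this have "x \<in> Z" using b by (auto simp: Z_def)
    ultimately show ?thesis using bmin by force
  qed
  \<comment> \<open>A smooth truncation: zero for \<bar>s\<bar> \<le> 1 and the identity for
    \<bar>s\<bar> \<ge> 2.\<close>
  define h where "h s = s * (1 - \<theta> s)" for s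
  have "smooth h" unfolding h_def
    using smooth_mult[OF smooth_affine[of 1 0] smooth_minus[OF smooth_const \<theta>(1)]] by simp
  have h0: "h s = 0" if "\<bar>s\<bar> \<le> 1" for s using \<theta>(2) that by (simp add: h_def)
  have h1: "h s = s" if "\<bar>s\<bar> \<ge> 2" for s using \<theta>(3) that by (simp add: h_def)
  have h'0: "vderiv h 0 = 0"
  proof (rule DERIV_vderiv)
    have "open {-1<..<1::real}" by simp
    from has_field_derivative_transform_within_open[OF DERIV_const[of 0] this, of 0 h]
    show "(h has_real_derivative 0) (at 0)" using h0 by (auto simp: abs_le_iff)
  qed
  have h'1: "vderiv h s = 1" if "\<bar>s\<bar> \<ge> 3" for s
  proof (rule DERIV_vderiv)
    have "open {s::real. \<bar>s\<bar> > 2}" by (intro open_Collect_less continuous_intros)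
    from has_field_derivative_transform_within_open[OF DERIV_ident this, of s h]
    show "(h has_real_derivative 1) (at s)" using h1 that by auto
  qed
  obtain L1 where L1: "\<And>s. \<bar>vderiv h s\<bar> \<le> L1"
    using smooth_cutoff_bounded[OF smooth_continuous_on[OF smooth_vderiv[OF \<open>smooth h\<close>]] h'1] by blast
  have "continuous_on UNIV (\<lambda>s. 1 - \<theta> s)"
    by (intro continuous_intros smooth_continuous_on \<theta>)
  then obtain L2 where L2: "\<And>s. \<bar>1 - \<theta> s\<bar> \<le> L2"
    using smooth_cutoff_bounded[of "\<lambda>s. 1 - \<theta> s" 2 1] \<theta>(3) by auto
  define L where "L = max L1 L2"
  have L: "\<bar>vderiv h s\<bar> \<le> L" "\<bar>h s\<bar> \<le> L * \<bar>s\<bar>" for s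
  proof -
    show "\<bar>vderiv h s\<bar> \<le> L" using L1[of s] by (simp add: L_def le_max_iff_disj)
    have "\<bar>1 - \<theta> s\<bar> \<le> L" using L2[of s] by (simp add: L_def le_max_iff_disj)
    from mult_left_mono[OF this, of "\<bar>s\<bar>"] show "\<bar>h s\<bar> \<le> L * \<bar>s\<bar>"
      by (simp add: h_def abs_mult mult.commute)
  qed
  define k where "k n = real (Suc n)" for n
  have k: "k n > 0" for n by (simp add: k_def)
  \<comment> \<open>Rescaling shrinks the dead zone to the radius \<open>1 / k n\<close>, while
    \<open>vderiv (g n)\<close> and the ratio of \<open>g n s\<close> to \<open>s\<close> keep the
    bound \<open>L\<close> for all \<open>n\<close>. This supplies the integrable majorant
    below.\<close>
  define g where "g n s = h (k n * s) / k n" for n s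
  have g: "smooth (g n)" "\<And>s. \<bar>s\<bar> \<le> 1 / k n \<Longrightarrow> g n s = 0" for n
  proof -
    have "smooth (\<lambda>s. (1 / k n) * h (k n * s + 0))"
      by (intro smooth_mult smooth_const smooth_compose[OF \<open>smooth h\<close>] smooth_affine)
    then show "smooth (g n)" by (simp add: g_def[abs_def])
    show "g n s = 0" if "\<bar>s\<bar> \<le> 1 / k n" for s
      using that k[of n] unfolding g_def by (subst h0) (auto simp: abs_mult field_simps)
  qed
  have g': "vderiv (g n) s = vderiv h (k n * s)" for n s
  proof (rule DERIV_vderiv)
    have "((\<lambda>s. h (k n * s)) has_real_derivative vderiv h (k n * s) * k n) (at s)"
      using DERIV_chain2[OF smooth_DERIV[OF \<open>smooth h\<close>] DERIV_cmult_Id] .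
    from DERIV_cdivide[OF this, of "k n"]
    show "(g n has_real_derivative vderiv h (k n * s)) (at s)"
      using k[of n] by (simp add: g_def[abs_def])
  qed
  have gL: "\<bar>g n s\<bar> \<le> L * \<bar>s\<bar>" for n s
    using L(2)[of "k n * s"] k[of n] by (simp add: g_def abs_mult field_simps)
  define \<phi> where "\<phi> n x = (if a \<le> x \<and> x \<le> b then g n (u x) else 0)" for n x
  define \<phi>' where "\<phi>' n x = (if a \<le> x \<and> x \<le> b then vderiv h (k n * u x) * v x else 0)" for n x
  have \<phi>: "smooth (\<phi> n)" "(\<phi> n has_real_derivative \<phi>' n x) (at x)" for n x
  proof -
    have "1 / k n > 0" using k by simp
    note cut = cut_composition[OF smooth(1) a(1) \<open>u b = 0\<close> g(1) this g(2)]
    show "smooth (\<phi> n)"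
      unfolding \<phi>_def[abs_def] by (rule cut(1))
    show "(\<phi> n has_real_derivative \<phi>' n x) (at x)"
      using cut(2)[of n x]
      unfolding \<phi>_def[abs_def] \<phi>'_def g' vderiv_u by simp
  qed
  have vderiv_\<phi>: "vderiv (\<phi> n) x = \<phi>' n x" for n x
    using \<phi>(2) by (auto intro: DERIV_vderiv)
  have \<phi>_test: "\<phi> n \<in> test_functions" for n
    using \<phi>(1) by (rule test_functionI[of _ "max \<bar>a\<bar> \<bar>b\<bar>"]) (auto simp: \<phi>_def)
  let ?F = "\<lambda>n x. (vderiv (\<phi> n) x)\<^sup>2 + (V x - c) * (\<phi> n x)\<^sup>2"
  let ?f = "\<lambda>x. indicator {a..b} x * ((v x)\<^sup>2 + (V x - c) * (u x)\<^sup>2)"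
  let ?w = "\<lambda>x. indicator {a..b} x * (L\<^sup>2 * (v x)\<^sup>2 + (M + c) * L\<^sup>2 * (u x)\<^sup>2)"
  have [measurable]: "V \<in> borel_measurable borel" "u \<in> borel_measurable borel"
    "v \<in> borel_measurable borel" "\<phi> n \<in> borel_measurable borel"
    "vderiv (\<phi> n) \<in> borel_measurable borel" for n
    using smooth \<phi> V by (auto intro: smooth_borel_measurable smooth_vderiv)
  have C: "continuous_on S u" "continuous_on S v" "continuous_on S V" for S
    using smooth V smooth_continuous_on by blast+
  have "(\<lambda>n. integral\<^sup>L lborel (?F n)) \<longlonglongrightarrow> integral\<^sup>L lborel ?f"
  proof (rule integral_dominated_convergence[where w = ?w])
    have "set_integrable lborel {a..b} (\<lambda>x. L\<^sup>2 * (v x)\<^sup>2 + (M + c) * L\<^sup>2 * (u x)\<^sup>2)"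
      by (intro borel_integrable_atLeastAtMost' continuous_intros C)
    then show "integrable lborel ?w" by (simp add: set_integrable_def)
    show "AE x in lborel. norm (?F n x) \<le> ?w x" for n
    proof (rule AE_I2)
      fix x
      show "norm (?F n x) \<le> ?w x"
      proof (cases "a \<le> x \<and> x \<le> b")
        case True
        have "(\<phi>' n x)\<^sup>2 \<le> (L * \<bar>v x\<bar>)\<^sup>2"
          using L(1)[of "k n * u x"] True
          by (intro power2_le_iff_abs_le[THEN iffD2]) (auto simp: \<phi>'_def abs_mult intro!: mult_right_mono)
        moreover have "(\<phi> n x)\<^sup>2 \<le> (L * \<bar>u x\<bar>)\<^sup>2"
          using gL[of n "u x"] True
          by (intro power2_le_iff_abs_le[THEN iffD2]) (auto simp: \<phi>_def intro: order.trans[OF abs_ge_zero])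
        then have "\<bar>V x - c\<bar> * (\<phi> n x)\<^sup>2 \<le> (M + c) * (L * \<bar>u x\<bar>)\<^sup>2"
          using VM[of x] c by (intro mult_mono) auto
        then have "\<bar>(V x - c) * (\<phi> n x)\<^sup>2\<bar> \<le> (M + c) * (L * \<bar>u x\<bar>)\<^sup>2"
          by (simp add: abs_mult)
        ultimately show ?thesis
          using True abs_triangle_ineq[of "(\<phi>' n x)\<^sup>2" "(V x - c) * (\<phi> n x)\<^sup>2"]
          unfolding vderiv_\<phi> by (simp add: power_mult_distrib mult.assoc)
      qed (auto simp: \<phi>_def \<phi>'_def vderiv_\<phi>)
    qed
    have "AE x in lborel. x \<noteq> a" "AE x in lborel. x \<noteq> b" by (simp_all add: AE_lborel_singleton)
    then show "AE x in lborel. (\<lambda>n. ?F n x) \<longlonglongrightarrow> ?f x"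
    proof eventually_elim
      case (elim x)
      show ?case
      proof (cases "a < x \<and> x < b")
        case True
        then have "u x > 0" using pos by blast
        obtain N where N: "real N > 3 / u x" using reals_Archimedean2 by blast
        \<comment> \<open>Once \<open>k n * u x\<close> is at least \<open>3\<close>, the truncation
          at \<open>u x\<close> is the identity with slope one, so the integrand already equals its
          limit.\<close>
        have "?F n x = ?f x" if "n \<ge> N" for n
        proof -
          have "3 / u x \<le> k n" using N that by (simp add: k_def)
          then have "\<bar>k n * u x\<bar> \<ge> 3" using \<open>u x > 0\<close> k[of n] by (simp add: field_simps)
          then have "vderiv h (k n * u x) = 1" "g n (u x) = u x"
            using h'1[of "k n * u x"] h1[of "k n * u x"] k[of n] by (auto simp: g_def)
          then show ?thesis using True unfolding vderiv_\<phi> by (simp add: \<phi>_def \<phi>'_def)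
        qed
        then show ?thesis by (intro tendsto_eventually eventually_sequentiallyI) blast
      next
        case False
        then have "?F n x = ?f x" for n using elim unfolding vderiv_\<phi> by (auto simp: \<phi>_def \<phi>'_def)
        then show ?thesis by simp
      qed
    qed
  qed measurable
  then have "0 \<le> integral\<^sup>L lborel ?f"
    by (rule LIMSEQ_le_const) (use form[OF \<phi>_test] in blast)
  obtain W where W: "\<And>x. (W has_real_derivative (u x)\<^sup>2) (at x)"
    using antiderivative_exists[of "\<lambda>x. (u x)\<^sup>2"] smooth by (auto intro: continuous_intros smooth_isCont)
  \<comment> \<open>Since \<open>(u v)' = v^2 + V u^2\<close> and \<open>u v\<close> vanishes at
    both ends, the form without \<open>c\<close> is zero on \<open>[a, b]\<close>. The shift by
    \<open>c\<close> makes it \<open>- c\<close> times the integral of \<open>u^2\<close>, which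
    contradicts nonnegativity of its limit representation.\<close>
  have "has_bochner_integral lborel
      (\<lambda>x. ((v x)\<^sup>2 + (V x - c) * (u x)\<^sup>2) * indicator {a..b} x)
      ((u b * v b - c * W b) - (u a * v a - c * W a))"
  proof (rule has_bochner_integral_FTC_Icc_real)
    show "((\<lambda>x. u x * v x - c * W x) has_real_derivative (v x)\<^sup>2 + (V x - c) * (u x)\<^sup>2) (at x)" for x
      by (rule derivative_eq_intros u v W refl)+ (simp add: power2_eq_square algebra_simps)
    show "isCont (\<lambda>x. (v x)\<^sup>2 + (V x - c) * (u x)\<^sup>2) x" for x
      by (intro continuous_intros smooth_isCont smooth V)
  qed (use \<open>a < b\<close> in simp)
  then have "integral\<^sup>L lborel ?f = c * (W a - W b)"
    using a \<open>u b = 0\<close> by (simp add: has_bochner_integral_iff mult.commute algebra_simps)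
  moreover have "W a < W b"
  proof (rule DERIV_pos_imp_increasing_open[OF \<open>a < b\<close>])
    show "\<exists>y. (W has_real_derivative y) (at x) \<and> 0 < y" if "a < x" "x < b" for x
      using W pos[OF that] by (intro exI[of _ "(u x)\<^sup>2"]) simp
    show "continuous_on {a..b} W"
      using W by (meson DERIV_isCont continuous_at_imp_continuous_on)
  qed
  ultimately show False
    using c \<open>0 \<le> integral\<^sup>L lborel ?f\<close> by (simp add: zero_le_mult_iff)
qed

text \<open>The witness is the logarithmic derivative \<open>v / u\<close> of the solution that
  starts with a zero of slope one at \<open>a\<close>; positivity of \<open>u\<close> makes it
  regular on the whole half-line to the right.\<close>

lemma riccati_solution_exists:
  fixes V :: "real \<Rightarrow> real"
  assumes V: "smooth V" and VM: "\<And>x. \<bar>V x\<bar> \<le> M" and c: "c > 0"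
    and form: "\<And>\<psi>. \<psi> \<in> test_functions \<Longrightarrow>
      0 \<le> (LINT x|lborel. (vderiv \<psi> x)\<^sup>2 + (V x - c) * (\<psi> x)\<^sup>2)"
    and \<theta>: "smooth \<theta>" "\<And>s. \<bar>s\<bar> \<le> 1 \<Longrightarrow> \<theta> s = 1" "\<And>s. \<bar>s\<bar> \<ge> 2 \<Longrightarrow> \<theta> s = (0::real)"
  shows "\<exists>r\<in>borel_measurable borel. \<forall>x>a. (r has_real_derivative V x - (r x)\<^sup>2) (at x)"
proof -
  obtain u v where uv: "u a = 0" "v a = 1" "\<And>x. (u has_real_derivative v x) (at x)"
      "\<And>x. (v has_real_derivative V x * u x) (at x)"
    using linear_ode_exists[of V M a] smooth_isCont[OF V] VM by blast
  have pos: "u x > 0" if "x > a" for x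
    by (rule ode_solution_positive[OF V VM c form \<theta> uv(3,4,1,2) that])
  have "smooth u" "smooth v" using smooth_ode_solution[OF V uv(3,4)] .
  then have "(\<lambda>x. v x / u x) \<in> borel_measurable borel"
    by (intro borel_measurable_divide smooth_borel_measurable)
  moreover have "((\<lambda>x. v x / u x) has_real_derivative V x - (v x / u x)\<^sup>2) (at x)" if "x > a" for x
    using DERIV_divide[OF uv(4,3), of x] pos[OF that]
    by (simp add: field_simps power2_eq_square)
  ultimately show ?thesis by blast
qed

section \<open>Approximation of functionals in \<open>H\<^sup>-\<^sup>1\<close>\<close>

definition H1_inner :: "(real \<Rightarrow> real) \<Rightarrow> (real \<Rightarrow> real) \<Rightarrow> real" where
  "H1_inner \<phi> \<psi> = (LINT x|lborel. \<phi> x * \<psi> x + vderiv \<phi> x * vderiv \<psi> x)"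

lemma test_mult2:
  fixes \<phi> :: "real \<Rightarrow> real"
  shows "\<phi> \<in> test_functions \<Longrightarrow> \<psi> \<in> test_functions \<Longrightarrow> (\<lambda>x. \<phi> x * \<psi> x) \<in> test_functions"
  by (simp add: test_mult test_smooth)

lemma test_integrable_mult:
  fixes \<phi> \<psi> :: "real \<Rightarrow> real"
  assumes "\<phi> \<in> test_functions" "\<psi> \<in> test_functions"
  shows "integrable lborel (\<lambda>x. \<phi> x * \<psi> x)"
  using test_integrable[OF test_mult2] assms by blast

lemma H1_inner_commute: "H1_inner \<phi> \<psi> = H1_inner \<psi> \<phi>"
  by (simp add: H1_inner_def mult.commute)

lemma H1_inner_add_right:
  assumes "\<phi> \<in> test_functions" "\<psi> \<in> test_functions" "\<xi> \<in> test_functions"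
  shows "H1_inner \<phi> (\<lambda>x. \<psi> x + t * \<xi> x) = H1_inner \<phi> \<psi> + t * H1_inner \<phi> \<xi>"
proof -
  have "H1_inner \<phi> (\<lambda>x. \<psi> x + t * \<xi> x) = (LINT x|lborel.
      (\<phi> x * \<psi> x + vderiv \<phi> x * vderiv \<psi> x) + t * (\<phi> x * \<xi> x + vderiv \<phi> x * vderiv \<xi> x))"
    unfolding H1_inner_def using assms
    by (simp add: vderiv_add vderiv_scale test_smooth smooth_mult smooth_const algebra_simps)
  also have "\<dots> = H1_inner \<phi> \<psi> + t * H1_inner \<phi> \<xi>"
    unfolding H1_inner_def using assms
    by (subst Bochner_Integration.integral_add)
       (auto intro!: Bochner_Integration.integrable_add integrable_mult_right test_integrable_mult test_vderiv)
  finally show ?thesis .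
qed

lemma H1_inner_self:
  assumes "\<phi> \<in> test_functions"
  shows "H1_inner \<phi> \<phi> = (LINT x|lborel. (\<phi> x)\<^sup>2) + (LINT x|lborel. (vderiv \<phi> x)\<^sup>2)"
    and "H1_inner \<phi> \<phi> = (H1_norm \<phi>)\<^sup>2"
proof -
  show *: "H1_inner \<phi> \<phi> = (LINT x|lborel. (\<phi> x)\<^sup>2) + (LINT x|lborel. (vderiv \<phi> x)\<^sup>2)"
    unfolding H1_inner_def power2_eq_square
    by (intro Bochner_Integration.integral_add test_integrable_mult test_vderiv assms)
  have "(LINT x|lborel. (\<phi> x)\<^sup>2) + (LINT x|lborel. (vderiv \<phi> x)\<^sup>2) \<ge> 0"
    by (intro add_nonneg_nonneg Bochner_Integration.integral_nonneg) auto
  then show "H1_inner \<phi> \<phi> = (H1_norm \<phi>)\<^sup>2"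
    unfolding * H1_norm_def by simp
qed

lemma H1_norm_nonneg: "H1_norm \<phi> \<ge> 0"
  unfolding H1_norm_def by (intro real_sqrt_ge_zero add_nonneg_nonneg Bochner_Integration.integral_nonneg) auto

text \<open>Integration by parts shows that pairing with \<phi> in H1 is integration against the
  smooth function \<phi> - \<phi>''. This is where the smooth potentials come from.\<close>

lemma H1_inner_eq_integral:
  assumes \<phi>: "\<phi> \<in> test_functions" and \<psi>: "\<psi> \<in> test_functions"
  shows "H1_inner \<phi> \<psi> = (LINT x|lborel. (\<phi> x - vderiv (vderiv \<phi>) x) * \<psi> x)"
proof -
  have D: "vderiv (\<lambda>x. vderiv \<phi> x * \<psi> x) x = vderiv (vderiv \<phi>) x * \<psi> x + vderiv \<phi> x * vderiv \<psi> x" for x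
    using DERIV_mult[OF smooth_DERIV[OF test_smooth[OF test_vderiv[OF \<phi>]]] smooth_DERIV[OF test_smooth[OF \<psi>]], of x]
    by (intro DERIV_vderiv) (simp add: algebra_simps)
  have "0 = (LINT x|lborel. vderiv (vderiv \<phi>) x * \<psi> x + vderiv \<phi> x * vderiv \<psi> x)"
    using test_integral_vderiv[OF test_mult2[OF test_vderiv[OF \<phi>] \<psi>]] unfolding D by simp
  also have "\<dots> = (LINT x|lborel. vderiv (vderiv \<phi>) x * \<psi> x) + (LINT x|lborel. vderiv \<phi> x * vderiv \<psi> x)"
    by (intro Bochner_Integration.integral_add test_integrable_mult test_vderiv assms)
  finally have "(LINT x|lborel. vderiv \<phi> x * vderiv \<psi> x) = - (LINT x|lborel. vderiv (vderiv \<phi>) x * \<psi> x)"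
    by simp
  then show ?thesis
    unfolding H1_inner_def left_diff_distrib
    by (subst Bochner_Integration.integral_add Bochner_Integration.integral_diff;
        (intro test_integrable_mult test_vderiv assms)?)+ simp
qed

text \<open>The one-dimensional Sobolev embedding: \<open>\<phi>^2\<close> is the integral of
  \<open>2 \<phi> \<phi>'\<close> from a point where \<phi> vanishes, and
  \<open>2 \<phi> \<phi>' \<le> \<phi>^2 + \<phi>'^2\<close>.\<close>

lemma square_le_H1_norm:
  assumes \<phi>: "\<phi> \<in> test_functions"
  shows "(\<phi> x)\<^sup>2 \<le> (H1_norm \<phi>)\<^sup>2"
proof -
  obtain M where M: "smooth \<phi>" "\<And>x. \<bar>x\<bar> \<ge> M \<Longrightarrow> \<phi> x = 0"
    using test_functionE[OF \<phi>] by metis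
  define a where "a = min (- M) x"
  have "\<phi> a = 0" "a \<le> x" using M(2)[of a] by (auto simp: a_def)
  let ?f = "\<lambda>x. 2 * \<phi> x * vderiv \<phi> x"
  have "has_bochner_integral lborel (\<lambda>y. ?f y * indicator {a..x} y) ((\<phi> x)\<^sup>2 - (\<phi> a)\<^sup>2)"
  proof (rule has_bochner_integral_FTC_Icc_real[OF \<open>a \<le> x\<close>])
    show "((\<lambda>x. (\<phi> x)\<^sup>2) has_real_derivative ?f x) (at x)" for x
      using smooth_DERIV[OF M(1)] by (auto intro!: derivative_eq_intros)
    show "isCont ?f x" for x
      by (intro continuous_intros smooth_isCont smooth_vderiv M)
  qed
  then have int: "integrable lborel (\<lambda>y. ?f y * indicator {a..x} y)"
    and eq: "(LINT y|lborel. ?f y * indicator {a..x} y) = (\<phi> x)\<^sup>2"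
    using \<open>\<phi> a = 0\<close> by (auto simp: has_bochner_integral_iff)
  have "(\<phi> x)\<^sup>2 = (LINT y|lborel. ?f y * indicator {a..x} y)"
    by (rule eq[symmetric])
  also have "\<dots> \<le> (LINT x|lborel. \<phi> x * \<phi> x + vderiv \<phi> x * vderiv \<phi> x)"
  proof (rule Bochner_Integration.integral_mono[OF int])
    show "integrable lborel (\<lambda>x. \<phi> x * \<phi> x + vderiv \<phi> x * vderiv \<phi> x)"
      by (intro Bochner_Integration.integrable_add test_integrable_mult test_vderiv \<phi>)
    fix y :: real
    have "?f y \<le> \<phi> y * \<phi> y + vderiv \<phi> y * vderiv \<phi> y"
      using zero_le_power2[of "\<phi> y - vderiv \<phi> y"] by (simp add: power2_eq_square algebra_simps)
    then show "?f y * indicator {a..x} y \<le> \<phi> y * \<phi> y + vderiv \<phi> y * vderiv \<phi> y"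
      by (simp add: indicator_def)
  qed
  also have "\<dots> = (H1_norm \<phi>)\<^sup>2"
    using H1_inner_self(2)[OF \<phi>] by (simp add: H1_inner_def)
  finally show ?thesis .
qed

text \<open>The Schroedinger form evaluates \<open>q\<close> at \<psi>^2, so an error measured by
  \<open>H1_norm\<close> must be turned into one quadratic in \<psi>. The sup bound takes out one
  factor \<psi>^2 from each term.\<close>

lemma H1_norm_power2_le:
  assumes \<psi>: "\<psi> \<in> test_functions"
  shows "H1_norm (\<lambda>x. (\<psi> x)\<^sup>2) \<le> 2 * (H1_norm \<psi>)\<^sup>2"
proof (rule power2_le_imp_le)
  let ?B = "(H1_norm \<psi>)\<^sup>2"
  have "(H1_norm (\<lambda>x. (\<psi> x)\<^sup>2))\<^sup>2 = (LINT x|lborel. (\<psi> x)\<^sup>2 * (\<psi> x)\<^sup>2 +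
      vderiv (\<lambda>x. (\<psi> x)\<^sup>2) x * vderiv (\<lambda>x. (\<psi> x)\<^sup>2) x)"
    using H1_inner_self(2)[OF test_power2[OF \<psi>]] by (simp add: H1_inner_def)
  also have "\<dots> \<le> (LINT x|lborel. 4 * ?B * (\<psi> x * \<psi> x + vderiv \<psi> x * vderiv \<psi> x))"
  proof (rule Bochner_Integration.integral_mono)
    show "(\<psi> x)\<^sup>2 * (\<psi> x)\<^sup>2 + vderiv (\<lambda>x. (\<psi> x)\<^sup>2) x * vderiv (\<lambda>x. (\<psi> x)\<^sup>2) x
        \<le> 4 * ?B * (\<psi> x * \<psi> x + vderiv \<psi> x * vderiv \<psi> x)" for x
    proof -
      have "(\<psi> x)\<^sup>2 * ((\<psi> x)\<^sup>2 + 4 * (vderiv \<psi> x)\<^sup>2) \<le> ?B * (4 * ((\<psi> x)\<^sup>2 + (vderiv \<psi> x)\<^sup>2))"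
        using square_le_H1_norm[OF \<psi>] by (intro mult_mono) auto
      then show ?thesis
        unfolding vderiv_power2[OF test_smooth[OF \<psi>]] by (simp add: power2_eq_square algebra_simps)
    qed
  qed (intro Bochner_Integration.integrable_add integrable_mult_right test_integrable_mult
      test_vderiv test_power2 \<psi>)+
  also have "\<dots> = 4 * ?B * ?B"
    using H1_inner_self(2)[OF \<psi>] by (simp add: H1_inner_def)
  finally show "(H1_norm (\<lambda>x. (\<psi> x)\<^sup>2))\<^sup>2 \<le> (2 * (H1_norm \<psi>)\<^sup>2)\<^sup>2"
    by (simp add: power2_eq_square)
qed simp

text \<open>The discriminant criterion. It serves for the Cauchy-Schwarz inequality and for reading
  off how nearly an approximate minimiser satisfies the Euler-Lagrange equation.\<close>

lemma quadratic_nonneg_discriminant: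
  fixes a d n :: real
  assumes nonneg: "\<And>t. 0 \<le> a + 2 * t * d + t\<^sup>2 * n" and "n \<ge> 0"
  shows "d\<^sup>2 \<le> a * n"
proof (cases "n = 0")
  case True
  \<comment> \<open>For nonzero \<open>d\<close> the chosen \<open>t\<close> would give the linear
    expression the value \<open>-1\<close>.\<close>
  then have "d = 0"
    using nonneg[of "- (a + 1) / (2 * d)"] by (cases "d = 0") (auto simp: field_simps)
  then show ?thesis using True by simp
next
  case False
  then show ?thesis
    using nonneg[of "- d / n"] \<open>n \<ge> 0\<close> by (auto simp: field_simps power2_eq_square)
qed

text \<open>Riesz representation without completeness: a minimising sequence of
  \<open>\<parallel>\<phi>\<parallel>\<^sup>2 - 2 q \<phi>\<close> over test functions represents \<open>q\<close> up to small errors.\<close>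

lemma H_minus1_approximation:
  assumes q: "q \<in> H_minus1"
  obtains \<phi> B where "\<And>n::nat. \<phi> n \<in> test_functions"
    and "\<And>n \<psi>. \<psi> \<in> test_functions \<Longrightarrow> \<bar>H1_inner (\<phi> n) \<psi> - q \<psi>\<bar> \<le> (1/4) ^ n * H1_norm \<psi>"
    and "\<And>n. (H1_norm (\<lambda>x. \<phi> (Suc n) x - \<phi> n x))\<^sup>2 \<le> 4 * (1/16) ^ n"
    and "\<And>n. H1_norm (\<phi> n) \<le> B"
proof -
  have dist: "q \<in> distributions" and "\<exists>C. \<forall>\<psi>\<in>test_functions. \<bar>q \<psi>\<bar> \<le> C * H1_norm \<psi>"
    using q by (simp_all add: H_minus1_def)
  then obtain C where C: "\<And>\<psi>. \<psi> \<in> test_functions \<Longrightarrow> \<bar>q \<psi>\<bar> \<le> C * H1_norm \<psi>" by metis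
  have q_add: "q (\<lambda>x. \<phi> x + \<psi> x) = q \<phi> + q \<psi>"
    if "\<phi> \<in> test_functions" "\<psi> \<in> test_functions" for \<phi> \<psi>
    using dist that by (simp add: distributions_def)
  have q_scale: "q (\<lambda>x. c * \<phi> x) = c * q \<phi>" if "\<phi> \<in> test_functions" for \<phi> c
    using dist that by (simp add: distributions_def)
  \<comment> \<open>A representative of \<open>q\<close> would minimise this functional. Along lines
    it is exactly quadratic, and its first variation is twice the representation error.\<close>
  define J where "J \<phi> = H1_inner \<phi> \<phi> - 2 * q \<phi>" for \<phi>
  have J_line: "J (\<lambda>x. \<phi> x + t * \<psi> x) = J \<phi> + 2 * t * (H1_inner \<phi> \<psi> - q \<psi>) + t\<^sup>2 * H1_inner \<psi> \<psi>"
    if "\<phi> \<in> test_functions" "\<psi> \<in> test_functions" for \<phi> \<psi> t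
  proof -
    define \<xi> where "\<xi> = (\<lambda>x. \<phi> x + t * \<psi> x)"
    have \<xi>: "\<xi> \<in> test_functions"
      unfolding \<xi>_def by (intro test_add test_scale that)
    have "H1_inner \<xi> \<xi> = H1_inner \<phi> \<xi> + t * H1_inner \<psi> \<xi>"
      using H1_inner_add_right[OF \<xi> that, of t] by (simp add: \<xi>_def[symmetric] H1_inner_commute)
    also have "\<dots> = (H1_inner \<phi> \<phi> + t * H1_inner \<phi> \<psi>) + t * (H1_inner \<phi> \<psi> + t * H1_inner \<psi> \<psi>)"
      unfolding \<xi>_def using that
      by (simp only: H1_inner_add_right H1_inner_commute[of \<psi> \<phi>])
    finally have "H1_inner \<xi> \<xi> = \<dots>" .
    moreover have "q \<xi> = q \<phi> + t * q \<psi>"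
      unfolding \<xi>_def using q_add[OF that(1) test_scale[OF that(2)], of t] q_scale[OF that(2), of t]
      by (rule trans[OF _ arg_cong])
    ultimately show ?thesis
      unfolding \<xi>_def[symmetric] J_def by (simp add: power2_eq_square algebra_simps)
  qed
  define m where "m = Inf (J ` test_functions)"
  have J_ge: "(H1_norm \<phi>)\<^sup>2 - 2 * C * H1_norm \<phi> \<le> J \<phi>" if "\<phi> \<in> test_functions" for \<phi>
    using C[OF that] H1_inner_self(2)[OF that] by (simp add: J_def abs_le_iff)
  have "- C\<^sup>2 \<le> J \<phi>" if "\<phi> \<in> test_functions" for \<phi>
    using J_ge[OF that] zero_le_power2[of "H1_norm \<phi> - C"] by (simp add: power2_eq_square algebra_simps)
  then have bdd: "bdd_below (J ` test_functions)" by (intro bdd_belowI[of _ "- C\<^sup>2"]) blast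
  have zero: "(\<lambda>x. 0) \<in> (test_functions :: (real \<Rightarrow> real) set)"
    by (rule test_functionI[OF smooth_const]) simp
  have m: "m \<le> J \<phi>" if "\<phi> \<in> test_functions" for \<phi>
    unfolding m_def using that bdd by (intro cInf_lower) auto
  have "\<exists>\<phi>\<in>test_functions. J \<phi> < m + (1/16) ^ n" for n :: nat
    using cInf_lessD[of "J ` test_functions" "m + (1/16) ^ n"] zero by (auto simp: m_def)
  then obtain \<phi> where \<phi>: "\<And>n. \<phi> n \<in> test_functions" "\<And>n. J (\<phi> n) < m + (1/16) ^ n"
    by metis
  show thesis
  \<comment> \<open>The bound comes from \<open>J (\<phi> n) < 1\<close>, valid because
    \<open>J\<close> vanishes at zero, after completing the square in
    \<open>H1_norm (\<phi> n)\<close>.\<close>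
  proof (rule that[of \<phi> "\<bar>C\<bar> + sqrt (1 + C\<^sup>2)"])
    fix n \<psi> assume \<psi>: "(\<psi> :: real \<Rightarrow> real) \<in> test_functions"
    \<comment> \<open>Moving from \<phi> n along \<psi> lowers \<open>J\<close> by at most
      \<open>(1/16) ^ n\<close>. The discriminant turns this into a first variation of size
      \<open>(1/4) ^ n\<close>.\<close>
    have "(H1_inner (\<phi> n) \<psi> - q \<psi>)\<^sup>2 \<le> (1/16) ^ n * H1_inner \<psi> \<psi>"
    proof (rule quadratic_nonneg_discriminant)
      fix t
      have "m \<le> J (\<lambda>x. \<phi> n x + t * \<psi> x)"
        by (intro m test_add test_scale \<phi> \<psi>)
      then show "0 \<le> (1/16) ^ n + 2 * t * (H1_inner (\<phi> n) \<psi> - q \<psi>) + t\<^sup>2 * H1_inner \<psi> \<psi>"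
        using J_line[OF \<phi>(1) \<psi>, of n t] \<phi>(2)[of n] by linarith
    qed (simp add: H1_inner_self(2) \<psi>)
    also have "\<dots> = ((1/4) ^ n * H1_norm \<psi>)\<^sup>2"
      by (simp add: H1_inner_self(2) \<psi> power_mult_distrib flip: power_mult)
         (simp add: power_mult mult.commute[of n] power2_eq_square)
    finally show "\<bar>H1_inner (\<phi> n) \<psi> - q \<psi>\<bar> \<le> (1/4) ^ n * H1_norm \<psi>"
      using H1_norm_nonneg[of \<psi>] by (simp add: abs_le_square_iff[symmetric])
  next
    fix n
    define d where "d x = \<phi> (Suc n) x - \<phi> n x" for x
    have d: "d \<in> test_functions"
      using test_add[OF \<phi>(1)[of "Suc n"] test_scale[OF \<phi>(1)[of n], of "-1"]] by (simp add: d_def[abs_def])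
    have "(\<lambda>x. \<phi> n x + 1 * d x) = \<phi> (Suc n)" by (simp add: d_def)
    then have "J (\<phi> (Suc n)) = J (\<phi> n) + 2 * (H1_inner (\<phi> n) d - q d) + H1_inner d d"
      using J_line[OF \<phi>(1) d, of n 1] by simp
    \<comment> \<open>The value at the midpoint of two successive terms. By the parallelogram
      identity, \<open>H1_inner d d / 2\<close> is the sum of the end values minus twice the
      midpoint value, hence at most \<open>2 * (1/16) ^ n\<close>.\<close>
    moreover have "m \<le> J (\<phi> n) + (H1_inner (\<phi> n) d - q d) + H1_inner d d / 4"
      using m[OF test_add[OF \<phi>(1) test_scale[OF d]], of n "1/2"] J_line[OF \<phi>(1) d, of n "1/2"]
      by (simp add: power2_eq_square)
    moreover have "J (\<phi> (Suc n)) < m + (1/16) ^ n"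
    proof -
      have "(1/16::real) ^ Suc n \<le> (1/16) ^ n" by (intro power_decreasing) auto
      with \<phi>(2)[of "Suc n"] show ?thesis by (rule less_le_trans[OF _ add_left_mono])
    qed
    ultimately have "H1_inner d d \<le> 4 * (1/16) ^ n"
      using \<phi>(2)[of n] by argo
    then show "(H1_norm (\<lambda>x. \<phi> (Suc n) x - \<phi> n x))\<^sup>2 \<le> 4 * (1/16) ^ n"
      using H1_inner_self(2)[OF d] by (simp add: d_def[abs_def])
  next
    fix n
    have "J (\<lambda>x. 0) = 0"
      using q_scale[OF zero, of 0] by (simp add: J_def H1_inner_def)
    then have "J (\<phi> n) < 1"
      using \<phi>(2)[of n] m[OF zero] power_le_one[of "1/16::real" n] by simp
    then have "(H1_norm (\<phi> n) - C)\<^sup>2 \<le> 1 + C\<^sup>2"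
      using J_ge[OF \<phi>(1)[of n]] by (simp add: power2_eq_square algebra_simps)
    then have "H1_norm (\<phi> n) - C \<le> sqrt (1 + C\<^sup>2)"
      by (intro real_le_rsqrt)
    then show "H1_norm (\<phi> n) \<le> \<bar>C\<bar> + sqrt (1 + C\<^sup>2)" by linarith
  qed (rule \<phi>)
qed

section \<open>Positivity of the approximating forms\<close>

lemma Schroedinger_nonneg_real:
  assumes "Schroedinger_nonneg q" and \<psi>: "\<psi> \<in> test_functions"
  shows "0 \<le> (LINT x|lborel. (vderiv \<psi> x)\<^sup>2) + q (\<lambda>x. (\<psi> x)\<^sup>2)"
proof -
  let ?f = "\<lambda>x. complex_of_real (\<psi> x)"
  have "?f \<in> test_functions"
    using smooth_bounded_linear(1)[OF bounded_linear_of_real test_smooth[OF \<psi>]] \<psi>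
    by (auto simp: test_functions_iff)
  then have "0 \<le> Schroedinger_form q ?f"
    using assms(1) by (simp add: Schroedinger_nonneg_def)
  then show ?thesis
    by (simp add: Schroedinger_form_def smooth_bounded_linear(2)[OF bounded_linear_of_real test_smooth[OF \<psi>]])
qed

text \<open>Replacing \<open>q\<close> costs at most \<open>2 * \<epsilon>\<close> times the squared
  H1 norm of \<psi>. Its zeroth order part goes into the potential, its first order part into the
  kinetic term, and division by \<open>1 + 2 * \<epsilon>\<close> restores the kinetic coefficient
  one.\<close>

lemma approximation_form_nonneg:
  assumes q: "Schroedinger_nonneg q" and \<phi>: "\<phi> \<in> test_functions"
    and approx: "\<And>\<psi>. \<psi> \<in> test_functions \<Longrightarrow> \<bar>H1_inner \<phi> \<psi> - q \<psi>\<bar> \<le> \<epsilon> * H1_norm \<psi>"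
    and "\<epsilon> \<ge> 0" and \<psi>: "\<psi> \<in> test_functions"
  shows "0 \<le> (LINT x|lborel. (vderiv \<psi> x)\<^sup>2 +
    (\<phi> x - vderiv (vderiv \<phi>) x + 2 * \<epsilon>) / (1 + 2 * \<epsilon>) * (\<psi> x)\<^sup>2)"
proof -
  have int: "integrable lborel (\<lambda>x. (vderiv \<psi> x)\<^sup>2)" "integrable lborel (\<lambda>x. (\<psi> x)\<^sup>2)"
    "integrable lborel (\<lambda>x. (\<phi> x - vderiv (vderiv \<phi>) x) * (\<psi> x)\<^sup>2)"
    by (intro test_integrable test_power2 test_vderiv \<psi>,
        intro test_integrable test_power2 \<psi>,
        intro test_integrable test_mult test_power2 smooth_minus smooth_vderiv test_smooth \<phi> \<psi>)
  have "\<epsilon> * H1_norm (\<lambda>x. (\<psi> x)\<^sup>2) \<le> \<epsilon> * (2 * (H1_norm \<psi>)\<^sup>2)"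
    by (intro mult_left_mono H1_norm_power2_le \<psi> \<open>\<epsilon> \<ge> 0\<close>)
  then have "q (\<lambda>x. (\<psi> x)\<^sup>2) \<le> H1_inner \<phi> (\<lambda>x. (\<psi> x)\<^sup>2) + 2 * \<epsilon> * (H1_norm \<psi>)\<^sup>2"
    using approx[OF test_power2[OF \<psi>]] by (simp add: abs_le_iff)
  then have "0 \<le> (LINT x|lborel. (vderiv \<psi> x)\<^sup>2)
      + (LINT x|lborel. (\<phi> x - vderiv (vderiv \<phi>) x) * (\<psi> x)\<^sup>2)
      + 2 * \<epsilon> * ((LINT x|lborel. (\<psi> x)\<^sup>2) + (LINT x|lborel. (vderiv \<psi> x)\<^sup>2))"
    using Schroedinger_nonneg_real[OF q \<psi>] H1_inner_self[OF \<psi>]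
      H1_inner_eq_integral[OF \<phi> test_power2[OF \<psi>]] by simp
  also have "\<dots> = (LINT x|lborel. (vderiv \<psi> x)\<^sup>2 + (\<phi> x - vderiv (vderiv \<phi>) x) * (\<psi> x)\<^sup>2
      + 2 * \<epsilon> * ((\<psi> x)\<^sup>2 + (vderiv \<psi> x)\<^sup>2))"
    using int by simp
  also have "\<dots> = (LINT x|lborel. (1 + 2 * \<epsilon>) * ((vderiv \<psi> x)\<^sup>2 +
    (\<phi> x - vderiv (vderiv \<phi>) x + 2 * \<epsilon>) / (1 + 2 * \<epsilon>) * (\<psi> x)\<^sup>2))"
    using \<open>\<epsilon> \<ge> 0\<close> by (intro Bochner_Integration.integral_cong) (auto simp: divide_simps algebra_simps)
  finally show ?thesis
    using \<open>\<epsilon> \<ge> 0\<close> by (simp add: zero_le_mult_iff)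
qed

section \<open>Majorants and energy estimates\<close>

lemma power2_diff_le: "(a - b)\<^sup>2 \<le> 2 * a\<^sup>2 + 2 * b\<^sup>2" for a b :: real
  using zero_le_power2[of "a + b"] by (simp add: power2_eq_square algebra_simps)

lemma abs_le_one_plus_power2: "\<bar>a\<bar> \<le> 1 + a\<^sup>2" for a :: real
  using zero_le_power2[of "\<bar>a\<bar> - 1"] zero_le_power2[of a]
  by (simp add: power2_eq_square algebra_simps)

text \<open>This is the argument behind completeness of L2: a rapidly Cauchy sequence converges
  almost everywhere and has a common square-integrable majorant. Both are needed for dominated
  convergence.\<close>

lemma geometric_L2_differences_dominated:
  fixes f :: "nat \<Rightarrow> 'a \<Rightarrow> real"
  assumes [measurable]: "\<And>n. f n \<in> borel_measurable M" and f0: "integrable M (\<lambda>x. (f 0 x)\<^sup>2)"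
    and int: "\<And>n. integrable M (\<lambda>x. (f (Suc n) x - f n x)\<^sup>2)"
    and le: "\<And>n. (LINT x|M. (f (Suc n) x - f n x)\<^sup>2) \<le> C * (1/16) ^ n"
  obtains D where "integrable M D"
    and "AE x in M. (\<forall>n. (f n x)\<^sup>2 \<le> D x) \<and> convergent (\<lambda>n. f n x)"
proof -
  \<comment> \<open>The weight splits the decay \<open>(1/16) ^ n\<close>: the integrals of
    \<open>g n\<close> remain geometrically summable, and a finite pointwise sum still forces
    differences of order \<open>(1/2) ^ n\<close>.\<close>
  define g where "g n x = 4 ^ n * (f (Suc n) x - f n x)\<^sup>2" for n x
  have g: "integrable M (g n)" "0 \<le> g n x" for n x
    using int by (auto simp: g_def[abs_def])
  have "norm (LINT x|M. norm (g n x)) \<le> C * (1/4) ^ n" for n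
  proof -
    have "(LINT x|M. norm (g n x)) = 4 ^ n * (LINT x|M. (f (Suc n) x - f n x)\<^sup>2)"
      using g(2) by (simp add: g_def)
    also have "\<dots> \<le> 4 ^ n * (C * (1/16) ^ n)"
      by (intro mult_left_mono le) simp
    also have "\<dots> = C * (1/4) ^ n"
      by (simp add: power_mult_distrib[symmetric] mult.left_commute)
    finally show ?thesis by simp
  qed
  then have sum: "summable (\<lambda>n. LINT x|M. norm (g n x))"
    by (intro summable_comparison_test'[OF summable_mult[OF summable_geometric[of "1/4"]], of 0]) auto
  have "(\<integral>\<^sup>+ x. (\<Sum>n. ennreal (g n x)) \<partial>M) = (\<Sum>n. \<integral>\<^sup>+ x. ennreal (g n x) \<partial>M)"
    using g(1) by (intro nn_integral_suminf) auto
  also have "\<dots> = (\<Sum>n. ennreal (LINT x|M. norm (g n x)))"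
    using g by (intro suminf_cong) (simp add: nn_integral_eq_integral)
  also have "\<dots> \<noteq> \<infinity>"
    by (subst suminf_ennreal2[OF _ sum]) auto
  finally have "AE x in M. (\<Sum>n. ennreal (g n x)) \<noteq> \<infinity>"
    using g(1) by (intro nn_integral_PInf_AE) auto
  then have AE_sum: "AE x in M. summable (\<lambda>n. g n x)"
    by eventually_elim (use g(2) in \<open>auto intro: summable_suminf_not_top\<close>)
  \<comment> \<open>With \<open>h^2\<close> the sum of the \<open>g n x\<close>, the total increment
    is at most \<open>2 * h\<close>, and \<open>2 * (2 * h)^2 = 8 * h^2\<close>.\<close>
  define D where "D x = 2 * (f 0 x)\<^sup>2 + 8 * (\<Sum>n. g n x)" for x
  have "integrable M (\<lambda>x. \<Sum>n. g n x)"
    using AE_sum g(2) by (intro integrable_suminf[OF g(1) _ sum]) simp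
  then have "integrable M D"
    unfolding D_def[abs_def] using f0 by simp
  moreover have "AE x in M. (\<forall>n. (f n x)\<^sup>2 \<le> D x) \<and> convergent (\<lambda>n. f n x)"
    using AE_sum
  proof eventually_elim
    case (elim x)
    define h where "h = sqrt (\<Sum>n. g n x)"
    have h: "h \<ge> 0" "h\<^sup>2 = (\<Sum>n. g n x)"
      using g(2) elim by (auto simp: h_def intro!: suminf_nonneg)
    have d: "\<bar>f (Suc n) x - f n x\<bar> \<le> (1/2) ^ n * h" for n
    proof -
      have "g n x \<le> (\<Sum>n. g n x)"
        using sum_le_suminf[OF elim, of "{n}"] g(2) by simp
      then have "(2 ^ n * (f (Suc n) x - f n x))\<^sup>2 \<le> h\<^sup>2"
        unfolding h(2) g_def power_mult_distrib by (simp add: power_mult[symmetric] power2_eq_square power_mult_distrib[symmetric])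
      then have "\<bar>2 ^ n * (f (Suc n) x - f n x)\<bar> \<le> h"
        using h(1) by (simp add: abs_le_square_iff[symmetric])
      then have "2 ^ n * \<bar>f (Suc n) x - f n x\<bar> \<le> h" by (simp only: abs_mult power_abs abs_numeral)
      then show ?thesis by (simp add: power_one_over field_simps)
    qed
    have geo: "summable (\<lambda>n. (1/2::real) ^ n * h)"
      by (intro summable_mult2 summable_geometric) simp
    have summable: "summable (\<lambda>n. f (Suc n) x - f n x)"
      by (rule summable_comparison_test'[OF geo, of 0]) (use d in simp)
    have tele: "f n x = f 0 x + (\<Sum>k<n. f (Suc k) x - f k x)" for n
      using sum_lessThan_telescope[of "\<lambda>n. f n x" n] by simp
    have "convergent (\<lambda>n. f 0 x + (\<Sum>k<n. f (Suc k) x - f k x))"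
      using summable_LIMSEQ[OF summable]
      by (intro convergent_add convergent_const) (auto simp: convergent_def)
    then have "convergent (\<lambda>n. f n x)"
      unfolding tele[symmetric] .
    moreover have "(f n x)\<^sup>2 \<le> D x" for n
    proof -
      have "\<bar>\<Sum>k<n. f (Suc k) x - f k x\<bar> \<le> (\<Sum>k<n. (1/2) ^ k * h)"
        using d by (intro order.trans[OF sum_abs] sum_mono) simp
      also have "\<dots> \<le> (\<Sum>k. (1/2) ^ k * h)"
        using h(1) by (intro sum_le_suminf geo) auto
      also have "\<dots> = 2 * h"
        by (simp add: suminf_mult2[symmetric] suminf_geometric)
      finally have "\<bar>\<Sum>k<n. f (Suc k) x - f k x\<bar> \<le> 2 * h" .
      then have "(\<Sum>k<n. f (Suc k) x - f k x)\<^sup>2 \<le> 4 * h\<^sup>2"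
        using abs_le_square_iff[of _ "2 * h"] h(1) by (simp add: power_mult_distrib)
      then show ?thesis
        using power2_diff_le[of "f 0 x" "- (\<Sum>k<n. f (Suc k) x - f k x)"]
        unfolding D_def h(2)[symmetric] tele[of n] by simp
    qed
    ultimately show ?case by blast
  qed
  ultimately show thesis by (rule that)
qed

text \<open>The Riccati equation tested with \<open>\<theta>\<^sup>2\<close> bounds the solution: the cross term
  is absorbed by \<open>2 r \<theta> \<theta>' \<le> (r \<theta>)\<^sup>2 / 2 + 2 \<theta>'\<^sup>2\<close>.\<close>

lemma local_energy_bound:
  fixes r \<theta> :: "real \<Rightarrow> real"
  assumes \<theta>: "\<theta> \<in> test_functions" and int: "integrable lborel (\<lambda>x. (r x)\<^sup>2 * (\<theta> x)\<^sup>2)"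
    and eq: "(LINT x|lborel. (r x)\<^sup>2 * (\<theta> x)\<^sup>2) = A + (LINT x|lborel. r x * vderiv (\<lambda>x. (\<theta> x)\<^sup>2) x)"
  shows "(LINT x|lborel. (r x)\<^sup>2 * (\<theta> x)\<^sup>2) \<le> 2 * A + 4 * (LINT x|lborel. (vderiv \<theta> x)\<^sup>2)"
proof -
  have int': "integrable lborel (\<lambda>x. (vderiv \<theta> x)\<^sup>2)"
    by (intro test_integrable test_power2 test_vderiv \<theta>)
  have "(LINT x|lborel. r x * vderiv (\<lambda>x. (\<theta> x)\<^sup>2) x)
      \<le> (LINT x|lborel. (r x)\<^sup>2 * (\<theta> x)\<^sup>2 / 2 + 2 * (vderiv \<theta> x)\<^sup>2)"
  proof (rule integral_mono')
    show "r x * vderiv (\<lambda>x. (\<theta> x)\<^sup>2) x \<le> (r x)\<^sup>2 * (\<theta> x)\<^sup>2 / 2 + 2 * (vderiv \<theta> x)\<^sup>2" for x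
      using zero_le_power2[of "r x * \<theta> x - 2 * vderiv \<theta> x"]
      unfolding vderiv_power2[OF test_smooth[OF \<theta>]] by (simp add: power2_eq_square algebra_simps)
  qed (use int int' in auto)
  also have "\<dots> = (LINT x|lborel. (r x)\<^sup>2 * (\<theta> x)\<^sup>2) / 2 + 2 * (LINT x|lborel. (vderiv \<theta> x)\<^sup>2)"
    using int int' by simp
  finally show ?thesis using eq by argo
qed

lemma integrable_continuous_cutoff:
  fixes f g :: "real \<Rightarrow> real"
  assumes "continuous_on {-R..R} f" "continuous_on {-R..R} g" and "\<And>x. \<bar>x\<bar> > R \<Longrightarrow> g x = 0"
  shows "integrable lborel (\<lambda>x. f x * g x)"
proof -
  have "set_integrable lborel {-R..R} (\<lambda>x. f x * g x)"
    by (intro borel_integrable_atLeastAtMost' continuous_intros assms)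
  moreover have "(\<lambda>x. indicator {-R..R} x *\<^sub>R (f x * g x)) = (\<lambda>x. f x * g x)"
  proof
    fix x show "indicator {-R..R} x *\<^sub>R (f x * g x) = f x * g x"
      using assms(3)[of x] by (cases "\<bar>x\<bar> > R") (auto simp: indicator_def)
  qed
  ultimately show ?thesis by (simp add: set_integrable_def)
qed

text \<open>The derivative of \<open>r \<psi>\<close> is
  \<open>(V - r^2) \<psi> + r \<psi>'\<close>, and it integrates to zero because \<psi> vanishes at
  both ends.\<close>

lemma riccati_weak_form:
  fixes r V \<psi> :: "real \<Rightarrow> real"
  assumes r: "\<And>x. \<bar>x\<bar> \<le> R \<Longrightarrow> (r has_real_derivative V x - (r x)\<^sup>2) (at x)"
    and V: "smooth V" and \<psi>: "smooth \<psi>" "\<And>x. \<bar>x\<bar> \<ge> R \<Longrightarrow> \<psi> x = 0" and "R > 0"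
  shows "integrable lborel (\<lambda>x. (r x)\<^sup>2 * \<psi> x)"
    and "(LINT x|lborel. (r x)\<^sup>2 * \<psi> x)
      = (LINT x|lborel. V x * \<psi> x) + (LINT x|lborel. r x * vderiv \<psi> x)"
proof -
  have \<psi>': "vderiv \<psi> x = 0" if "\<bar>x\<bar> > R" for x
    by (rule vderiv_zero_outside[OF _ that]) (simp add: \<psi>)
  have isCont_r: "isCont r x" if "\<bar>x\<bar> \<le> R" for x
    using r[OF that] by (rule DERIV_isCont)
  then have cont: "continuous_on {-R..R} r"
    by (intro continuous_at_imp_continuous_on) (auto simp: abs_le_iff)
  have int: "integrable lborel (\<lambda>x. (r x)\<^sup>2 * \<psi> x)" "integrable lborel (\<lambda>x. V x * \<psi> x)"
    "integrable lborel (\<lambda>x. r x * vderiv \<psi> x)"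
    using \<psi>(2) \<psi>' integrable_continuous_cutoff[of R] smooth_continuous_on[OF \<psi>(1)]
      smooth_continuous_on[OF V] smooth_continuous_on[OF smooth_vderiv[OF \<psi>(1)]]
      cont continuous_on_power[OF cont, of 2]
    by simp_all
  then show "integrable lborel (\<lambda>x. (r x)\<^sup>2 * \<psi> x)" by blast
  have "has_bochner_integral lborel (\<lambda>x. (V x - (r x)\<^sup>2) * \<psi> x + r x * vderiv \<psi> x) 0"
  proof (rule has_bochner_integral_deriv_zero[of "-R" R "\<lambda>x. r x * \<psi> x"])
    fix x assume "-R \<le> x" "x \<le> R"
    then have x: "\<bar>x\<bar> \<le> R" by simp
    show "((\<lambda>x. r x * \<psi> x) has_real_derivative (V x - (r x)\<^sup>2) * \<psi> x + r x * vderiv \<psi> x) (at x)"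
      using DERIV_mult[OF r[OF x] smooth_DERIV[OF \<psi>(1)]] by (simp add: mult.commute)
    show "isCont (\<lambda>x. (V x - (r x)\<^sup>2) * \<psi> x + r x * vderiv \<psi> x) x"
      by (intro continuous_intros isCont_r[OF x] smooth_isCont[OF V] smooth_isCont[OF \<psi>(1)]
          smooth_isCont[OF smooth_vderiv[OF \<psi>(1)]])
  next
    fix x assume "x < -R \<or> x > R"
    then show "(V x - (r x)\<^sup>2) * \<psi> x + r x * vderiv \<psi> x = 0"
      using \<psi>(2)[of x] \<psi>'[of x] by auto
  qed (use \<open>R > 0\<close> \<psi> in auto)
  then have "0 = (LINT x|lborel. V x * \<psi> x - (r x)\<^sup>2 * \<psi> x + r x * vderiv \<psi> x)"
    by (simp add: has_bochner_integral_iff left_diff_distrib)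
  also have "\<dots> = (LINT x|lborel. V x * \<psi> x) - (LINT x|lborel. (r x)\<^sup>2 * \<psi> x)
      + (LINT x|lborel. r x * vderiv \<psi> x)"
    using int by simp
  finally show "(LINT x|lborel. (r x)\<^sup>2 * \<psi> x)
      = (LINT x|lborel. V x * \<psi> x) + (LINT x|lborel. r x * vderiv \<psi> x)" by simp
qed

section \<open>Local solutions of the Miura equation\<close>

lemma cutoff_sequence_test:
  assumes "cutoff_sequence \<eta>" "n \<ge> 1"
  shows "\<eta> n \<in> test_functions" "\<And>x. \<eta> n x \<ge> 0" "\<And>x. \<bar>x\<bar> \<le> real n \<Longrightarrow> \<eta> n x = 1"
    "\<And>x. \<bar>x\<bar> \<ge> real n + 1 \<Longrightarrow> \<eta> n x = 0" "\<And>x. \<bar>vderiv (\<eta> n) x\<bar> \<le> 2"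
  using assms by (simp_all add: cutoff_sequence_def)

text \<open>Nonnegativity of the form gives a solution that is square integrable on bounded
  intervals; behaviour at infinity is handled separately by
  \<open>square_integrable_of_bounded_cutoff\<close>.\<close>

lemma local_Miura_preimage:
  assumes q: "q \<in> H_minus1" and nonneg: "Schroedinger_nonneg q" and \<eta>: "cutoff_sequence \<eta>"
  obtains r where "r \<in> borel_measurable borel"
    and "\<And>k::nat. integrable lborel (\<lambda>x. (r x)\<^sup>2 * indicator {- real k..real k} x)"
    and "\<And>\<psi>. \<psi> \<in> test_functions \<Longrightarrow>
      (LINT x|lborel. (r x)\<^sup>2 * \<psi> x) = q \<psi> + (LINT x|lborel. r x * vderiv \<psi> x)"
proof -
  obtain \<phi> B where \<phi>: "\<And>n::nat. \<phi> n \<in> test_functions"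
    and approx: "\<And>n \<psi>. \<psi> \<in> test_functions \<Longrightarrow> \<bar>H1_inner (\<phi> n) \<psi> - q \<psi>\<bar> \<le> (1/4) ^ n * H1_norm \<psi>"
    and cauchy: "\<And>n. (H1_norm (\<lambda>x. \<phi> (Suc n) x - \<phi> n x))\<^sup>2 \<le> 4 * (1/16) ^ n"
    and B: "\<And>n. H1_norm (\<phi> n) \<le> B"
    using H_minus1_approximation[OF q] by blast
  have B0: "B \<ge> 0" using B[of 0] H1_norm_nonneg[of "\<phi> 0"] by linarith
  define \<epsilon> :: "nat \<Rightarrow> real" where "\<epsilon> n = (1/4) ^ n" for n
  have \<epsilon>: "\<epsilon> n > 0" "\<epsilon> n \<le> 1" for n
    by (simp_all add: \<epsilon>_def power_le_one)
  have \<epsilon>_lim: "\<epsilon> \<longlonglongrightarrow> 0"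
    unfolding \<epsilon>_def[abs_def] by (rule LIMSEQ_power_zero) simp
  define \<phi>' where "\<phi>' n = vderiv (\<phi> n)" for n
  have \<phi>': "\<phi>' n \<in> test_functions" "smooth (\<phi>' n)" for n
    unfolding \<phi>'_def by (auto intro: test_vderiv test_smooth \<phi>)
  have \<phi>'_sq: "(LINT x|lborel. (\<phi>' n x)\<^sup>2) \<le> B\<^sup>2" "integrable lborel (\<lambda>x. (\<phi>' n x)\<^sup>2)" for n
  proof -
    have "(LINT x|lborel. (\<phi>' n x)\<^sup>2) \<le> (H1_norm (\<phi> n))\<^sup>2"
      using H1_inner_self[OF \<phi>[of n]] by (simp add: \<phi>'_def)
    also have "\<dots> \<le> B\<^sup>2" by (intro power_mono B H1_norm_nonneg)
    finally show "(LINT x|lborel. (\<phi>' n x)\<^sup>2) \<le> B\<^sup>2" .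
    show "integrable lborel (\<lambda>x. (\<phi>' n x)\<^sup>2)" by (intro test_integrable test_power2 \<phi>')
  qed
  \<comment> \<open>Of the shift \<open>4 * \<epsilon> n\<close>, one half compensates the
    approximation error as in \<open>approximation_form_nonneg\<close>. The other half provides the
    gap \<open>2 * \<epsilon> n / (1 + 2 * \<epsilon> n)\<close> that strict positivity
    requires.\<close>
  define V where "V n x = 1 / (1 + 2 * \<epsilon> n) * (\<phi> n x - vderiv (\<phi>' n) x + 4 * \<epsilon> n)" for n x
  have V: "smooth (V n)" for n
    unfolding V_def[abs_def]
    by (intro smooth_mult smooth_const smooth_add smooth_minus smooth_vderiv test_smooth \<phi> \<phi>')
  have V_bounded: "\<exists>M. \<forall>x. \<bar>V n x\<bar> \<le> M" for n
  proof -
    obtain M where "\<And>x. \<bar>x\<bar> \<ge> M \<Longrightarrow> \<phi> n x = 0" using test_functionE[OF \<phi>] by metis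
    moreover obtain M' where "\<And>x. \<bar>x\<bar> \<ge> M' \<Longrightarrow> vderiv (\<phi>' n) x = 0"
      using test_functionE[OF \<phi>'(1)] by metis
    ultimately have "V n x = 1 / (1 + 2 * \<epsilon> n) * (4 * \<epsilon> n)" if "\<bar>x\<bar> \<ge> max M M'" for x
      using that by (simp add: V_def)
    then show ?thesis
      by (intro smooth_cutoff_bounded[OF smooth_continuous_on[OF V]])
  qed
  have form: "0 \<le> (LINT x|lborel. (vderiv \<psi> x)\<^sup>2 + (V n x - 2 * \<epsilon> n / (1 + 2 * \<epsilon> n)) * (\<psi> x)\<^sup>2)"
    if "\<psi> \<in> test_functions" for \<psi> n
  proof -
    have "V n x - 2 * \<epsilon> n / (1 + 2 * \<epsilon> n) = (\<phi> n x - vderiv (vderiv (\<phi> n)) x + 2 * \<epsilon> n) / (1 + 2 * \<epsilon> n)" for x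
      by (simp add: V_def \<phi>'_def diff_divide_distrib add_divide_distrib)
    then show ?thesis
      using approximation_form_nonneg[OF nonneg \<phi>[of n] approx _ that] \<epsilon>[of n]
      by (simp add: \<epsilon>_def)
  qed
  have V_int: "(LINT x|lborel. V n x * \<psi> x)
      = (H1_inner (\<phi> n) \<psi> + 4 * \<epsilon> n * (LINT x|lborel. \<psi> x)) / (1 + 2 * \<epsilon> n)"
    if "\<psi> \<in> test_functions" for \<psi> n
  proof -
    have int: "integrable lborel (\<lambda>x. (\<phi> n x - vderiv (\<phi>' n) x) * \<psi> x)"
      by (intro test_integrable test_mult that smooth_minus smooth_vderiv test_smooth \<phi> \<phi>')
    have "(LINT x|lborel. V n x * \<psi> x)
        = (LINT x|lborel. ((\<phi> n x - vderiv (\<phi>' n) x) * \<psi> x + 4 * \<epsilon> n * \<psi> x) / (1 + 2 * \<epsilon> n))"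
      by (intro Bochner_Integration.integral_cong) (simp_all add: V_def ring_distribs diff_divide_distrib add_divide_distrib)
    also have "\<dots> = ((LINT x|lborel. (\<phi> n x - vderiv (\<phi>' n) x) * \<psi> x)
        + 4 * \<epsilon> n * (LINT x|lborel. \<psi> x)) / (1 + 2 * \<epsilon> n)"
      using int test_integrable[OF that] by simp
    finally show ?thesis
      using H1_inner_eq_integral[OF \<phi> that] by (simp add: \<phi>'_def)
  qed
  have V_lim: "(\<lambda>n. LINT x|lborel. V n x * \<psi> x) \<longlonglongrightarrow> q \<psi>" if "\<psi> \<in> test_functions" for \<psi>
  proof -
    have "(\<lambda>n. H1_inner (\<phi> n) \<psi> - q \<psi>) \<longlonglongrightarrow> 0"
    proof (rule Lim_null_comparison)
      show "\<forall>\<^sub>F n in sequentially. norm (H1_inner (\<phi> n) \<psi> - q \<psi>) \<le> \<epsilon> n * H1_norm \<psi>"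
        using approx[OF that] by (simp add: \<epsilon>_def)
      show "(\<lambda>n. \<epsilon> n * H1_norm \<psi>) \<longlonglongrightarrow> 0"
        using tendsto_mult_right[OF \<epsilon>_lim] by simp
    qed
    then have "(\<lambda>n. H1_inner (\<phi> n) \<psi>) \<longlonglongrightarrow> q \<psi>"
      by (rule LIM_zero_cancel)
    then have "(\<lambda>n. (H1_inner (\<phi> n) \<psi> + 4 * \<epsilon> n * (LINT x|lborel. \<psi> x)) / (1 + 2 * \<epsilon> n))
        \<longlonglongrightarrow> (q \<psi> + 4 * 0 * (LINT x|lborel. \<psi> x)) / (1 + 2 * 0)"
      by (intro tendsto_intros \<epsilon>_lim) auto
    then show ?thesis using V_int[OF that] by simp
  qed
  have "\<exists>r\<in>borel_measurable borel. \<forall>x>- real n. (r has_real_derivative V n x - (r x)\<^sup>2) (at x)" for n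
  proof -
    obtain M where M: "\<And>x. \<bar>V n x\<bar> \<le> M" using V_bounded by blast
    note \<eta>1 = cutoff_sequence_test[OF \<eta> order_refl]
    show ?thesis
    proof (rule riccati_solution_exists[OF V M _ form])
      show "2 * \<epsilon> n / (1 + 2 * \<epsilon> n) > 0" using \<epsilon>[of n] by simp
      show "smooth (\<eta> 1)" using \<eta>1(1) by (rule test_smooth)
    qed (use \<eta>1 in auto)
  qed
  then obtain r where r_meas [measurable]: "\<And>n. r n \<in> borel_measurable borel"
    and r: "\<And>n x. x > - real n \<Longrightarrow> (r n has_real_derivative V n x - (r n x)\<^sup>2) (at x)"
    by metis
  define K where "K = B + 4"
  \<comment> \<open>Subtracting the \<phi>' term cancels the second derivative of \<phi> in
    \<open>V n\<close>, which has no uniform bound. What remains of \<open>V n\<close> is at most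
    \<open>K\<close>, since \<phi> is bounded by \<open>B\<close> and \<epsilon> by one, so
    \<open>G n\<close> is nondecreasing.\<close>
  define G where "G n x = K * x - r n x - \<phi>' n x / (1 + 2 * \<epsilon> n)" for n x
  have G_deriv: "\<exists>y\<ge>0. (G n has_real_derivative y) (at x)" if "x > - real n" for n x
  proof -
    have "(G n has_real_derivative
        K - (V n x - (r n x)\<^sup>2) - vderiv (\<phi>' n) x / (1 + 2 * \<epsilon> n)) (at x)"
      unfolding G_def[abs_def]
      by (intro DERIV_diff DERIV_cdivide smooth_DERIV \<phi>' r that DERIV_cmult_Id)
    moreover have "0 \<le> K - (V n x - (r n x)\<^sup>2) - vderiv (\<phi>' n) x / (1 + 2 * \<epsilon> n)"
    proof -
      have "\<phi> n x \<le> B"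
      proof -
        have "\<bar>\<phi> n x\<bar> \<le> \<bar>H1_norm (\<phi> n)\<bar>"
          using square_le_H1_norm[OF \<phi>] by (simp add: abs_le_square_iff)
        then show ?thesis using B[of n] H1_norm_nonneg[of "\<phi> n"] by linarith
      qed
      then have "\<phi> n x + 4 * \<epsilon> n \<le> K * 1"
        using \<epsilon>(2)[of n] by (simp add: K_def)
      also have "\<dots> \<le> K * (1 + 2 * \<epsilon> n)"
        using \<epsilon>(1)[of n] B0 by (intro mult_left_mono) (auto simp: K_def)
      finally have "(\<phi> n x + 4 * \<epsilon> n) / (1 + 2 * \<epsilon> n) \<le> K"
        using \<epsilon>(1)[of n] by (simp add: divide_le_eq add_pos_pos)
      moreover have "V n x + vderiv (\<phi>' n) x / (1 + 2 * \<epsilon> n) = (\<phi> n x + 4 * \<epsilon> n) / (1 + 2 * \<epsilon> n)"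
        by (simp add: V_def diff_divide_distrib add_divide_distrib)
      ultimately show ?thesis using zero_le_power2[of "r n x"] by linarith
    qed
    ultimately show ?thesis by blast
  qed
  have G_mono: "G n x \<le> G n y" if "- real n < x" "x \<le> y" for n x y
  proof (rule DERIV_nonneg_imp_nondecreasing[OF that(2)])
    fix z assume "x \<le> z" "z \<le> y"
    then have "- real n < z" using that by linarith
    then show "\<exists>d. (G n has_real_derivative d) (at z) \<and> 0 \<le> d" using G_deriv by blast
  qed
  have weak: "integrable lborel (\<lambda>x. (r n x)\<^sup>2 * \<psi> x)"
      "(LINT x|lborel. (r n x)\<^sup>2 * \<psi> x)
        = (LINT x|lborel. V n x * \<psi> x) + (LINT x|lborel. r n x * vderiv \<psi> x)"
    if "smooth \<psi>" "\<And>x. \<bar>x\<bar> \<ge> R \<Longrightarrow> \<psi> x = 0" "R > 0" "R < real n" for \<psi> n R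
  proof -
    have "(r n has_real_derivative V n x - (r n x)\<^sup>2) (at x)" if "\<bar>x\<bar> \<le> R" for x
      using that \<open>R < real n\<close> by (intro r) auto
    note riccati_weak_form[OF this V that(1,2,3)]
    then show "integrable lborel (\<lambda>x. (r n x)\<^sup>2 * \<psi> x)"
      "(LINT x|lborel. (r n x)\<^sup>2 * \<psi> x)
        = (LINT x|lborel. V n x * \<psi> x) + (LINT x|lborel. r n x * vderiv \<psi> x)" by blast+
  qed
  \<comment> \<open>The cutoff \<eta> k vanishes from radius \<open>k + 1\<close> on. For
    \<open>n\<close> at least \<open>k + 2\<close> this lies inside the half-line where the Riccati
    equation holds.\<close>
  have energy: "\<exists>E. \<forall>n\<ge>k + 2. integrable lborel (\<lambda>x. (r n x)\<^sup>2 * (\<eta> k x)\<^sup>2) \<and>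
      (LINT x|lborel. (r n x)\<^sup>2 * (\<eta> k x)\<^sup>2) \<le> E" if k: "k \<ge> 1" for k
  proof -
    note \<eta>k = cutoff_sequence_test[OF \<eta> k]
    have sq: "(\<lambda>x. (\<eta> k x)\<^sup>2) \<in> test_functions" by (rule test_power2[OF \<eta>k(1)])
    have "Bseq (\<lambda>n. LINT x|lborel. V n x * (\<eta> k x)\<^sup>2)"
      using V_lim[OF sq] by (intro convergent_imp_Bseq) (auto simp: convergent_def)
    then obtain A where A: "\<And>n. \<bar>LINT x|lborel. V n x * (\<eta> k x)\<^sup>2\<bar> \<le> A"
      by (auto simp: Bseq_def)
    have "integrable lborel (\<lambda>x. (r n x)\<^sup>2 * (\<eta> k x)\<^sup>2) \<and>
      (LINT x|lborel. (r n x)\<^sup>2 * (\<eta> k x)\<^sup>2) \<le> 2 * A + 4 * (LINT x|lborel. (vderiv (\<eta> k) x)\<^sup>2)"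
      if "n \<ge> k + 2" for n
    proof -
      have "real k + 1 < real n" using that by linarith
      note w = weak[OF test_smooth[OF sq] _ _ this]
      have "integrable lborel (\<lambda>x. (r n x)\<^sup>2 * (\<eta> k x)\<^sup>2)" by (rule w(1)) (auto simp: \<eta>k)
      moreover from this have "(LINT x|lborel. (r n x)\<^sup>2 * (\<eta> k x)\<^sup>2) \<le>
          2 * (LINT x|lborel. V n x * (\<eta> k x)\<^sup>2) + 4 * (LINT x|lborel. (vderiv (\<eta> k) x)\<^sup>2)"
        by (rule local_energy_bound[OF \<eta>k(1)]) (rule w(2); simp add: \<eta>k)
      ultimately show ?thesis using A[of n] by (auto simp: abs_le_iff)
    qed
    then show ?thesis by blast
  qed
  then have "\<forall>k\<in>{1..}. \<exists>E. \<forall>n\<ge>k + 2. integrable lborel (\<lambda>x. (r n x)\<^sup>2 * (\<eta> k x)\<^sup>2) \<and>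
      (LINT x|lborel. (r n x)\<^sup>2 * (\<eta> k x)\<^sup>2) \<le> E" by simp
  from bchoice[OF this] obtain E where E: "\<And>k n. k \<ge> 1 \<Longrightarrow> n \<ge> k + 2 \<Longrightarrow> integrable lborel (\<lambda>x. (r n x)\<^sup>2 * (\<eta> k x)\<^sup>2)"
      "\<And>k n. k \<ge> 1 \<Longrightarrow> n \<ge> k + 2 \<Longrightarrow> (LINT x|lborel. (r n x)\<^sup>2 * (\<eta> k x)\<^sup>2) \<le> E k"
    by auto
  \<comment> \<open>On the interval of radius \<open>k\<close>, the size of \<open>G n\<close> is at
    most \<open>K * k + 2\<close> plus the squares of \<open>r n\<close> and \<phi>' n, whose
    weighted integrals are bounded by \<open>E k\<close> and \<open>B^2\<close>.\<close>
  define C where "C k = K * k + 2 + E k + B\<^sup>2" for k :: nat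
  have G_bound: "\<bar>G n x\<bar> \<le> C k" if k: "k \<ge> 1" and n: "n \<ge> k + 2" and x: "\<bar>x\<bar> \<le> real k - 1" for k n x
  proof -
    note \<eta>k = cutoff_sequence_test[OF \<eta> k]
    let ?H = "\<lambda>y. (r n y)\<^sup>2 * (\<eta> k y)\<^sup>2 + (\<phi>' n y)\<^sup>2"
    have H: "integrable lborel ?H" "integral\<^sup>L lborel ?H \<le> E k + B\<^sup>2"
      using E[OF k n] \<phi>'_sq[of n] by auto
    have G_H: "\<bar>G n y\<bar> \<le> K * k + 2 + ?H y" if "\<bar>y\<bar> \<le> real k" for y
    proof -
      have "\<bar>\<phi>' n y / (1 + 2 * \<epsilon> n)\<bar> \<le> \<bar>\<phi>' n y\<bar>"
        using \<epsilon>(1)[of n] by (simp add: abs_div divide_le_eq mult_le_cancel_left1)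
      moreover have "\<bar>K * y\<bar> \<le> K * k"
        using that B0 by (simp add: abs_mult K_def mult_left_mono)
      ultimately have "\<bar>G n y\<bar> \<le> K * k + (1 + (r n y)\<^sup>2) + (1 + (\<phi>' n y)\<^sup>2)"
        using abs_le_one_plus_power2[of "r n y"] abs_le_one_plus_power2[of "\<phi>' n y"] unfolding G_def by linarith
      then show ?thesis using \<eta>k(3)[OF that] by simp
    qed
    have lebesgue: "c \<le> integral\<^sup>L lborel ?H"
      if "\<And>y. y \<in> {a..a + 1} \<Longrightarrow> c \<le> ?H y" for a c
    proof -
      have "c = (LINT y|lborel. c * indicator {a..a + 1} y)" by simp
      also have "\<dots> \<le> integral\<^sup>L lborel ?H"
        using that by (intro integral_mono' H) (auto simp: indicator_def)
      finally show ?thesis .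
    qed
    \<comment> \<open>Monotonicity turns the integral bound into a pointwise one:
      \<open>G n x\<close> is at most every value on the unit interval ending at
      \<open>real k\<close>. The unit interval starting at \<open>- real k\<close> gives the lower
      bound.\<close>
    have "G n x - (K * k + 2) \<le> integral\<^sup>L lborel ?H"
    proof (rule lebesgue[of "real k - 1"])
      fix y assume "y \<in> {real k - 1..real k - 1 + 1}"
      then have "\<bar>y\<bar> \<le> real k" "G n x \<le> G n y"
        using x n by (auto intro!: G_mono)
      then show "G n x - (K * k + 2) \<le> ?H y" using G_H[of y] by linarith
    qed
    moreover have "- G n x - (K * k + 2) \<le> integral\<^sup>L lborel ?H"
    proof (rule lebesgue[of "- real k"])
      fix y assume "y \<in> {- real k..- real k + 1}"
      then have "\<bar>y\<bar> \<le> real k" "G n y \<le> G n x"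
        using x n k by (auto intro!: G_mono)
      then show "- G n x - (K * k + 2) \<le> ?H y" using G_H[of y] by linarith
    qed
    ultimately show ?thesis using H(2) by (simp add: C_def)
  qed
  \<comment> \<open>Helly's theorem wants uniformly bounded monotone functions on the whole line.
    The arctangent gives the bound, and freezing the argument at \<open>1 - real n\<close> avoids
    the region where \<open>G n\<close> need not be monotone.\<close>
  define g where "g n x = arctan (G n (max x (1 - real n)))" for n x
  have "\<exists>s. strict_mono (s :: nat \<Rightarrow> nat) \<and> (\<exists>F. (\<forall>x. continuous (at_right x) F) \<and> mono F \<and>
      (\<forall>x. \<bar>F x\<bar> \<le> pi / 2) \<and> (\<forall>x. continuous (at x) F \<longrightarrow> (\<lambda>n. g (s n) x) \<longlonglongrightarrow> F x))"
  proof (rule Helly_selection)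
    fix n
    show "mono (g n)"
      unfolding g_def by (intro monoI arctan_monotone' G_mono) auto
    fix x
    show "\<bar>g n x\<bar> \<le> pi / 2"
      using arctan_bounded[of "G n (max x (1 - real n))"] by (auto simp: g_def abs_le_iff)
    have "isCont (G n) (max x (1 - real n))"
      using G_deriv[of n "max x (1 - real n)"] DERIV_isCont by fastforce
    moreover have "isCont (\<lambda>x. max x (1 - real n)) x" by (intro continuous_intros)
    ultimately have "isCont (\<lambda>x. G n (max x (1 - real n))) x" by (rule isCont_o2[rotated])
    then show "continuous (at_right x) (g n)"
      unfolding g_def[abs_def] by (rule continuous_at_imp_continuous_at_within[OF continuous_arctan])
  qed
  then obtain s F where s: "strict_mono (s :: nat \<Rightarrow> nat)" and F: "mono F"
    and g_lim: "\<And>x. isCont F x \<Longrightarrow> (\<lambda>n. g (s n) x) \<longlonglongrightarrow> F x"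
    by blast
  have G_lim: "(\<lambda>n. G (s n) x) \<longlonglongrightarrow> tan (F x)" if "isCont F x" for x
  proof -
    obtain k :: nat where "real k > \<bar>x\<bar> + 1" using reals_Archimedean2 by blast
    then have k: "k \<ge> 1" "\<bar>x\<bar> \<le> real k - 1" by linarith+
    have g_eq: "g (s n) x = arctan (G (s n) x)" and g_le: "\<bar>g (s n) x\<bar> \<le> arctan (C k)" if "n \<ge> k + 2" for n
    proof -
      have sn: "s n \<ge> k + 2" using seq_suble[OF s, of n] that by linarith
      then show "g (s n) x = arctan (G (s n) x)" using k by (simp add: g_def max_absorb1)
      then show "\<bar>g (s n) x\<bar> \<le> arctan (C k)"
        using G_bound[OF k(1) sn k(2)] arctan_monotone'[of "G (s n) x" "C k"]
          arctan_monotone'[of "- C k" "G (s n) x"] by (simp add: abs_le_iff arctan_minus)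
    qed
    \<comment> \<open>The local bound on \<open>G n\<close> keeps the limit strictly inside the
      interval where \<open>tan\<close> is continuous, so the arctangent can be undone.\<close>
    have "\<bar>F x\<bar> \<le> arctan (C k)"
      by (rule LIMSEQ_le_const2[OF tendsto_rabs[OF g_lim[OF that]]]) (use g_le in blast)
    then have "\<bar>F x\<bar> < pi / 2" using arctan_ubound[of "C k"] by linarith
    then have "- (pi / 2) < F x" "F x < pi / 2" by linarith+
    then have "cos (F x) \<noteq> 0" using cos_gt_zero_pi[of "F x"] by simp
    then have "(\<lambda>n. tan (g (s n) x)) \<longlonglongrightarrow> tan (F x)"
      by (intro isCont_tendsto_compose[OF isCont_tan g_lim[OF that]])
    moreover have "\<forall>\<^sub>F n in sequentially. tan (g (s n) x) = G (s n) x"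
      using g_eq by (intro eventually_sequentiallyI[of "k + 2"]) (simp add: tan_arctan)
    ultimately show ?thesis by (rule Lim_transform_eventually)
  qed
  \<comment> \<open>A monotone function has at most countably many discontinuities, so convergence
    at continuity points is convergence almost everywhere.\<close>
  have AE_F: "AE x in lborel. isCont F x"
  proof -
    have "{x. \<not> isCont F x} \<in> null_sets lborel"
      by (intro countable_imp_null_set_lborel mono_ctble_discont F)
    from AE_not_in[OF this] show ?thesis by simp
  qed
  have [measurable]: "\<phi>' n \<in> borel_measurable borel" for n
    by (intro smooth_borel_measurable \<phi>')
  obtain D where D: "integrable lborel D"
    and AE_D: "AE x in lborel. (\<forall>n. (\<phi>' n x)\<^sup>2 \<le> D x) \<and> convergent (\<lambda>n. \<phi>' n x)"
  proof (rule geometric_L2_differences_dominated[of \<phi>' lborel 4])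
    have diff: "(\<lambda>x. \<phi> (Suc n) x - \<phi> n x) \<in> test_functions" for n
      using test_add[OF \<phi>[of "Suc n"] test_scale[OF \<phi>[of n], of "-1"]] by simp
    have vderiv_diff: "vderiv (\<lambda>x. \<phi> (Suc n) x - \<phi> n x) x = \<phi>' (Suc n) x - \<phi>' n x" for n x
      unfolding \<phi>'_def by (intro DERIV_vderiv DERIV_diff smooth_DERIV test_smooth \<phi>)
    show "integrable lborel (\<lambda>x. (\<phi>' (Suc n) x - \<phi>' n x)\<^sup>2)" for n
      using test_integrable[OF test_power2[OF test_vderiv[OF diff[of n]]]] by (simp add: vderiv_diff)
    show "(LINT x|lborel. (\<phi>' (Suc n) x - \<phi>' n x)\<^sup>2) \<le> 4 * (1/16) ^ n" for n
    proof -
      have "(LINT x|lborel. (\<phi>' (Suc n) x - \<phi>' n x)\<^sup>2) \<le> (H1_norm (\<lambda>x. \<phi> (Suc n) x - \<phi> n x))\<^sup>2"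
        using H1_inner_self[OF diff[of n]] by (simp add: vderiv_diff)
      then show ?thesis using cauchy[of n] by (rule order.trans)
    qed
  qed (auto intro: \<phi>'_sq)
  \<comment> \<open>Solving the definition of \<open>G n\<close> for \<open>r n\<close> and passing
    to the limit, where \<open>1 + 2 * \<epsilon> n\<close> tends to one.\<close>
  define \<rho> where "\<rho> x = K * x - tan (F x) - lim (\<lambda>n. \<phi>' n x)" for x
  have [measurable]: "F \<in> borel_measurable borel" using F by (rule borel_measurable_mono)
  have [measurable]: "(\<lambda>x. lim (\<lambda>n. \<phi>' n x)) \<in> borel_measurable borel"
    by (rule borel_measurable_lim_metric) measurable
  have \<rho>_meas [measurable]: "\<rho> \<in> borel_measurable borel"
    unfolding \<rho>_def[abs_def] tan_def by measurable
  have r_lim: "AE x in lborel. (\<lambda>n. r (s n) x) \<longlonglongrightarrow> \<rho> x"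
    using AE_F AE_D
  proof eventually_elim
    case (elim x)
    have "(\<lambda>n. \<phi>' n x / (1 + 2 * \<epsilon> n)) \<longlonglongrightarrow> lim (\<lambda>n. \<phi>' n x) / (1 + 2 * 0)"
      using elim by (intro tendsto_intros \<epsilon>_lim) (auto simp: convergent_LIMSEQ_iff)
    from LIMSEQ_subseq_LIMSEQ[OF this s]
    have "(\<lambda>n. K * x - G (s n) x - \<phi>' (s n) x / (1 + 2 * \<epsilon> (s n)))
        \<longlonglongrightarrow> K * x - tan (F x) - lim (\<lambda>n. \<phi>' n x)"
      using elim by (intro tendsto_intros G_lim) (auto simp: comp_def)
    then show ?case by (simp add: G_def \<rho>_def)
  qed
  \<comment> \<open>The exponent \<open>p\<close> treats the linear and the quadratic term of the
    weak equation together. The index shift \<open>k + 2\<close> starts the subsequence where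
    \<open>G_bound\<close> applies.\<close>
  have dominated: "integrable lborel (\<lambda>x. \<rho> x ^ p * h x) \<and>
      (\<lambda>n. LINT x|lborel. r (s (n + (k + 2))) x ^ p * h x) \<longlonglongrightarrow> (LINT x|lborel. \<rho> x ^ p * h x)"
    if k: "k \<ge> 1" and p: "p \<le> 2" and h [measurable]: "h \<in> borel_measurable borel"
      and hL: "\<And>x. \<bar>h x\<bar> \<le> L" and h0: "\<And>x. \<bar>x\<bar> > real k - 1 \<Longrightarrow> h x = 0" for k p h L
  proof -
    let ?Q = "K * k + C k"
    \<comment> \<open>Here \<open>r n\<close> is split into \<open>K * x - G n x\<close>, bounded by
      \<open>?Q\<close>, and the \<phi>' part, whose square is bounded by \<open>D\<close>.\<close>
    let ?w = "\<lambda>x. L * (indicator {- real k..real k} x * (1 + 2 * ?Q\<^sup>2) + 2 * D x)"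
    have w: "integrable lborel ?w" using D by simp
    have bound: "AE x in lborel. norm (r (s (n + (k + 2))) x ^ p * h x) \<le> ?w x" for n
      using AE_D
    proof eventually_elim
      case (elim x)
      let ?n = "s (n + (k + 2))"
      have n: "?n \<ge> k + 2" using seq_suble[OF s, of "n + (k + 2)"] by linarith
      have D0: "D x \<ge> 0" using elim zero_le_power2[of "\<phi>' 0 x"] order.trans by blast
      have L0: "L \<ge> 0" using hL[of 0] by linarith
      show ?case
      proof (cases "\<bar>x\<bar> \<le> real k - 1")
        case False
        then show ?thesis using h0[of x] D0 L0 by (simp add: indicator_def)
      next
        case True
        let ?a = "K * x - G ?n x" and ?b = "\<phi>' ?n x / (1 + 2 * \<epsilon> ?n)"
        have "\<bar>K * x\<bar> \<le> K * k"
          using True B0 by (simp add: abs_mult K_def mult_left_mono)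
        then have "\<bar>?a\<bar> \<le> ?Q" using G_bound[OF k n True] by linarith
        then have "?a\<^sup>2 \<le> ?Q\<^sup>2" by (rule abs_le_square_iff[THEN iffD1, OF order.trans[OF _ abs_ge_self]])
        moreover have "?b\<^sup>2 \<le> D x"
        proof -
          have "\<bar>?b\<bar> \<le> \<bar>\<phi>' ?n x\<bar>"
            using \<epsilon>(1)[of ?n] by (simp add: abs_div divide_le_eq mult_le_cancel_left1)
          then have "?b\<^sup>2 \<le> (\<phi>' ?n x)\<^sup>2" by (simp only: abs_le_square_iff)
          then show ?thesis using elim order.trans by blast
        qed
        moreover have "(r ?n x)\<^sup>2 \<le> 2 * ?a\<^sup>2 + 2 * ?b\<^sup>2"
        proof -
          have "r ?n x = ?a - ?b" by (simp add: G_def)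
          then show ?thesis using power2_diff_le[of ?a ?b] by (simp only:)
        qed
        moreover have "\<bar>r ?n x ^ p\<bar> \<le> 1 + (r ?n x)\<^sup>2"
        proof -
          have "p = 0 \<or> p = 1 \<or> p = 2" using p by auto
          then show ?thesis using abs_le_one_plus_power2[of "r ?n x"] by auto
        qed
        ultimately have "\<bar>r ?n x ^ p\<bar> \<le> 1 + 2 * ?Q\<^sup>2 + 2 * D x" by linarith
        then have "\<bar>r ?n x ^ p\<bar> * \<bar>h x\<bar> \<le> (1 + 2 * ?Q\<^sup>2 + 2 * D x) * L"
          using hL D0 by (intro mult_mono) auto
        moreover have "x \<in> {- real k..real k}" using True by auto
        ultimately show ?thesis by (simp add: abs_mult mult.commute)
      qed
    qed
    have lim: "AE x in lborel. (\<lambda>n. r (s (n + (k + 2))) x ^ p * h x) \<longlonglongrightarrow> \<rho> x ^ p * h x"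
      using r_lim
    proof eventually_elim
      case (elim x)
      show ?case by (intro tendsto_intros LIMSEQ_ignore_initial_segment[OF elim])
    qed
    show ?thesis
      using integrable_dominated_convergence[OF _ _ w lim bound]
        integral_dominated_convergence[OF _ _ w lim bound] by simp
  qed
  show thesis
  proof (rule that[of \<rho>])
    fix k :: nat
    \<comment> \<open>Domination is stated for functions supported in radius
      \<open>real k - 1\<close>, hence the instance \<open>k + 1\<close>.\<close>
    show "integrable lborel (\<lambda>x. (\<rho> x)\<^sup>2 * indicator {- real k..real k} x)"
      by (rule dominated[of "k + 1" 2 _ 1, THEN conjunct1]) (auto simp: indicator_def)
  next
    fix \<psi> assume \<psi>: "(\<psi> :: real \<Rightarrow> real) \<in> test_functions"
    obtain M where M: "smooth \<psi>" "M > 0" "\<And>x. \<bar>x\<bar> \<ge> M \<Longrightarrow> \<psi> x = 0" "\<And>x. \<bar>x\<bar> \<ge> M \<Longrightarrow> vderiv \<psi> x = 0"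
      using test_functionE[OF \<psi>] by metis
    obtain L1 L2 where "\<And>x. \<bar>\<psi> x\<bar> \<le> L1" "\<And>x. \<bar>vderiv \<psi> x\<bar> \<le> L2"
      using smooth_cutoff_bounded[OF smooth_continuous_on[OF M(1)] M(3)]
        smooth_cutoff_bounded[OF smooth_continuous_on[OF smooth_vderiv[OF M(1)]] M(4)] by metis
    note L = this
    obtain k :: nat where "real k > M + 1" using reals_Archimedean2 by blast
    then have k: "k \<ge> 1" "real k - 1 \<ge> M" using \<open>M > 0\<close> by linarith+
    have [measurable]: "\<psi> \<in> borel_measurable borel" "vderiv \<psi> \<in> borel_measurable borel"
      by (intro smooth_borel_measurable smooth_vderiv M)+
    let ?t = "\<lambda>n. s (n + (k + 2))"
    have lim2: "(\<lambda>n. LINT x|lborel. (r (?t n) x)\<^sup>2 * \<psi> x) \<longlonglongrightarrow> (LINT x|lborel. (\<rho> x)\<^sup>2 * \<psi> x)"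
      using dominated[of k 2 \<psi> L1] k M(3) L(1) by force
    have "(\<lambda>n. LINT x|lborel. r (?t n) x * vderiv \<psi> x) \<longlonglongrightarrow> (LINT x|lborel. \<rho> x * vderiv \<psi> x)"
      using dominated[of k 1 "vderiv \<psi>" L2] k M(4) L(2) by force
    moreover have "(\<lambda>n. LINT x|lborel. V (?t n) x * \<psi> x) \<longlonglongrightarrow> q \<psi>"
      using LIMSEQ_ignore_initial_segment[OF LIMSEQ_subseq_LIMSEQ[OF V_lim[OF \<psi>] s], of "k + 2"]
      by (simp add: comp_def)
    ultimately have "(\<lambda>n. (LINT x|lborel. V (?t n) x * \<psi> x) + (LINT x|lborel. r (?t n) x * vderiv \<psi> x))
        \<longlonglongrightarrow> q \<psi> + (LINT x|lborel. \<rho> x * vderiv \<psi> x)"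
      by (intro tendsto_add)
    moreover have "(LINT x|lborel. V (?t n) x * \<psi> x) + (LINT x|lborel. r (?t n) x * vderiv \<psi> x)
        = (LINT x|lborel. (r (?t n) x)\<^sup>2 * \<psi> x)" for n
    proof (rule weak(2)[OF M(1,3,2), symmetric])
      have "?t n \<ge> n + (k + 2)" by (rule seq_suble[OF s])
      then show "M < real (?t n)" using k by linarith
    qed
    ultimately show "(LINT x|lborel. (\<rho> x)\<^sup>2 * \<psi> x) = q \<psi> + (LINT x|lborel. \<rho> x * vderiv \<psi> x)"
      using lim2 LIMSEQ_unique by simp
  qed (rule \<rho>_meas)
qed

section \<open>The image of the Miura map\<close>

lemma cutoff_vderiv_le:
  assumes \<eta>: "cutoff_sequence \<eta>" and n: "n \<ge> 1"
  shows "\<bar>vderiv (\<eta> n) x\<bar> \<le> 2 * (indicator {real n..real n + 1} x + indicator {- real n - 1..- real n} x)"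
proof -
  note \<eta>n = cutoff_sequence_test[OF \<eta> n]
  consider "\<bar>x\<bar> < real n" | "\<bar>x\<bar> > real n + 1" | "x \<in> {real n..real n + 1}" | "x \<in> {- real n - 1..- real n}"
    by fastforce
  then show ?thesis
  proof cases
    case 1
    have "open {x::real. \<bar>x\<bar> < real n}" by (intro open_Collect_less continuous_intros)
    then have "(\<eta> n has_vector_derivative 0) (at x)"
      by (rule has_vector_derivative_transform_within_open[OF has_vector_derivative_const[of 1]])
         (use 1 \<eta>n(3) in auto)
    then show ?thesis by (simp add: vector_derivative_at)
  next
    case 2
    have "vderiv (\<eta> n) x = 0" by (rule vderiv_zero_outside[OF _ 2]) (simp add: \<eta>n)
    then show ?thesis by simp
  next
    case 3
    then show ?thesis using \<eta>n(5)[of x] by (auto simp: indicator_def)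
  next
    case 4
    then show ?thesis using \<eta>n(5)[of x] by (auto simp: indicator_def)
  qed
qed

lemma cutoff_vderiv_zero:
  assumes \<eta>: "cutoff_sequence \<eta>" and n: "n \<ge> 1" and "\<bar>x\<bar> < real n"
  shows "vderiv (\<eta> n) x = 0"
proof -
  have "x \<notin> {real n..real n + 1}" "x \<notin> {- real n - 1..- real n}"
    using \<open>\<bar>x\<bar> < real n\<close> by auto
  then show ?thesis using cutoff_vderiv_le[OF \<eta> n, of x] by simp
qed

text \<open>A cutoff sequence carries no explicit upper bound. The value one at the edge of the
  plateau, slope at most two and a transition of length one give the constant
  \<open>3\<close>.\<close>

lemma cutoff_le:
  assumes \<eta>: "cutoff_sequence \<eta>" and n: "n \<ge> 1"
  shows "\<eta> n x \<le> 3"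
proof -
  note \<eta>n = cutoff_sequence_test[OF \<eta> n]
  consider "\<bar>x\<bar> \<le> real n" | "\<bar>x\<bar> \<ge> real n + 1" | "real n < \<bar>x\<bar>" "\<bar>x\<bar> < real n + 1" by linarith
  then show ?thesis
  proof cases
    case 3
    define y where "y = (if x > 0 then real n else - real n)"
    have y: "\<bar>x - y\<bar> \<le> 1" "\<bar>y\<bar> = real n" using 3 by (auto simp: y_def)
    have "norm (\<eta> n x - \<eta> n y) \<le> 2 * norm (x - y)"
      by (rule field_differentiable_bound[where S = UNIV and f' = "vderiv (\<eta> n)"])
         (use smooth_DERIV[OF test_smooth[OF \<eta>n(1)]] \<eta>n(5) in auto)
    moreover have "\<eta> n y = 1" using \<eta>n(3) y(2) by simp
    ultimately have "\<bar>\<eta> n x - 1\<bar> \<le> 2 * 1"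
      using y(1) unfolding real_norm_def by (metis mult_left_mono order.trans zero_le_numeral)
    then show ?thesis by linarith
  qed (simp_all add: \<eta>n)
qed

lemma test_bounded:
  fixes h :: "real \<Rightarrow> real"
  assumes "h \<in> test_functions"
  obtains L where "\<And>x. \<bar>h x\<bar> \<le> L"
proof -
  obtain M where "smooth h" "\<And>x. \<bar>x\<bar> \<ge> M \<Longrightarrow> h x = 0"
    using test_functionE[OF assms] by metis
  then show thesis
    using smooth_cutoff_bounded[OF smooth_continuous_on] that by blast
qed

lemma L2_integrable_mult:
  fixes r h :: "real \<Rightarrow> real"
  assumes r: "r \<in> L2_functions" and h: "h \<in> test_functions"
  shows "integrable lborel (\<lambda>x. r x * h x)" "integrable lborel (\<lambda>x. (r x)\<^sup>2 * h x)"
proof -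
  have [measurable]: "r \<in> borel_measurable borel" "h \<in> borel_measurable borel"
    and r2: "integrable lborel (\<lambda>x. (r x)\<^sup>2)"
    using r smooth_borel_measurable[OF test_smooth[OF h]] by (auto simp: L2_functions_def)
  show "integrable lborel (\<lambda>x. r x * h x)"
  proof (rule Bochner_Integration.integrable_bound)
    show "integrable lborel (\<lambda>x. (r x)\<^sup>2 + (h x)\<^sup>2)"
      using r2 test_integrable[OF test_power2[OF h]] by simp
    have "\<bar>a * b\<bar> \<le> a\<^sup>2 + b\<^sup>2" for a b :: real
    proof -
      have "2 * \<bar>a * b\<bar> \<le> a\<^sup>2 + b\<^sup>2"
        using zero_le_power2[of "\<bar>a\<bar> - \<bar>b\<bar>"] by (simp add: power2_eq_square abs_mult algebra_simps)
      then show ?thesis using abs_ge_zero[of "a * b"] by linarith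
    qed
    then show "AE x in lborel. norm (r x * h x) \<le> norm ((r x)\<^sup>2 + (h x)\<^sup>2)" by simp
  qed measurable
  obtain L where L: "\<And>x. \<bar>h x\<bar> \<le> L" using test_bounded[OF h] by blast
  show "integrable lborel (\<lambda>x. (r x)\<^sup>2 * h x)"
  proof (rule Bochner_Integration.integrable_bound)
    show "integrable lborel (\<lambda>x. (r x)\<^sup>2 * L)" using r2 by simp
    show "AE x in lborel. norm ((r x)\<^sup>2 * h x) \<le> norm ((r x)\<^sup>2 * L)"
      using L by (auto simp: abs_mult intro!: AE_I2 mult_left_mono intro: order.trans[OF _ abs_ge_self])
  qed measurable
qed

text \<open>Completing the square separately for real and imaginary part: the derivative of
  \<open>a^2 + b^2\<close> supplies exactly the cross terms of
  \<open>(a' - r a)^2 + (b' - r b)^2\<close>.\<close>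

lemma Miura_nonneg:
  assumes r: "r \<in> L2_functions"
  shows "Schroedinger_nonneg (Miura r)"
  unfolding Schroedinger_nonneg_def
proof
  fix \<phi> assume \<phi>: "(\<phi> :: real \<Rightarrow> complex) \<in> test_functions"
  define a where "a x = Re (\<phi> x)" for x
  define b where "b x = Im (\<phi> x)" for x
  have ab: "a \<in> test_functions" "b \<in> test_functions"
    and vderiv_ab: "vderiv a x = Re (vderiv \<phi> x)" "vderiv b x = Im (vderiv \<phi> x)" for x
    using \<phi> smooth_bounded_linear[OF bounded_linear_Re test_smooth[OF \<phi>]]
      smooth_bounded_linear[OF bounded_linear_Im test_smooth[OF \<phi>]]
    by (force simp: test_functions_iff a_def[abs_def] b_def[abs_def])+
  note smooth_ab = ab[THEN test_smooth]
  define \<psi> where "\<psi> x = (a x)\<^sup>2 + (b x)\<^sup>2" for x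
  have \<psi>: "\<psi> \<in> test_functions"
    unfolding \<psi>_def[abs_def] by (intro test_add test_power2 ab)
  have vderiv_\<psi>: "vderiv \<psi> x = 2 * a x * vderiv a x + 2 * b x * vderiv b x" for x
    unfolding \<psi>_def[abs_def]
    by (subst vderiv_add) (simp_all add: vderiv_power2 smooth_ab test_smooth test_power2 ab)
  let ?e = "\<lambda>x. (vderiv a x)\<^sup>2 + (vderiv b x)\<^sup>2"
  have e: "integrable lborel ?e"
    by (intro Bochner_Integration.integrable_add test_integrable test_power2 test_vderiv ab)
  note int = e L2_integrable_mult(1)[OF r test_vderiv[OF \<psi>]] L2_integrable_mult(2)[OF r \<psi>]
  have "Schroedinger_form (Miura r) \<phi> = (LINT x|lborel. ?e x)
      + (- (LINT x|lborel. r x * vderiv \<psi> x) + (LINT x|lborel. (r x)\<^sup>2 * \<psi> x))"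
  proof -
    have "(\<lambda>x. (cmod (\<phi> x))\<^sup>2) = \<psi>"
      by (simp add: \<psi>_def a_def b_def cmod_power2 fun_eq_iff)
    moreover have "(\<lambda>x. (cmod (vderiv \<phi> x))\<^sup>2) = ?e"
      by (simp add: vderiv_ab cmod_power2)
    ultimately show ?thesis
      using \<psi> by (simp add: Schroedinger_form_def Miura_def)
  qed
  also have "\<dots> = (LINT x|lborel. ?e x - r x * vderiv \<psi> x + (r x)\<^sup>2 * \<psi> x)"
    using int by simp
  also have "\<dots> = (LINT x|lborel. (vderiv a x - r x * a x)\<^sup>2 + (vderiv b x - r x * b x)\<^sup>2)"
    by (intro Bochner_Integration.integral_cong) (simp_all add: vderiv_\<psi> \<psi>_def power2_eq_square algebra_simps)
  also have "\<dots> \<ge> 0" by simp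
  finally show "Schroedinger_form (Miura r) \<phi> \<ge> 0" .
qed

text \<open>The quadratic term converges by domination with \<open>3 r^2\<close>. The derivative
  term sees \<open>r\<close> only where the cutoff varies, and by Cauchy-Schwarz it is controlled by
  the tail of the integral of \<open>r^2\<close>.\<close>

lemma Miura_cutoff_tendsto:
  assumes r: "r \<in> L2_functions" and \<eta>: "cutoff_sequence \<eta>"
  shows "(\<lambda>n. Miura r (\<eta> n)) \<longlonglongrightarrow> (LINT x|lborel. (r x)\<^sup>2)"
proof -
  have [measurable]: "r \<in> borel_measurable borel" and r2: "integrable lborel (\<lambda>x. (r x)\<^sup>2)"
    using r by (auto simp: L2_functions_def)
  \<comment> \<open>The shift avoids index zero, where a cutoff sequence is unconstrained.\<close>
  let ?\<eta> = "\<lambda>n. \<eta> (Suc n)"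
  note \<eta>S = cutoff_sequence_test[OF \<eta>, of "Suc n" for n, simplified]
  have [measurable]: "?\<eta> n \<in> borel_measurable borel" "vderiv (?\<eta> n) \<in> borel_measurable borel" for n
    by (intro smooth_borel_measurable smooth_vderiv test_smooth \<eta>S)+
  have "(\<lambda>n. LINT x|lborel. (r x)\<^sup>2 * ?\<eta> n x) \<longlonglongrightarrow> (LINT x|lborel. (r x)\<^sup>2)"
  proof (rule integral_dominated_convergence)
    show "integrable lborel (\<lambda>x. (r x)\<^sup>2 * 3)" using r2 by simp
    show "AE x in lborel. norm ((r x)\<^sup>2 * ?\<eta> n x) \<le> (r x)\<^sup>2 * 3" for n
      using cutoff_le[OF \<eta>, of "Suc n"] \<eta>S(2)[of n] by (intro AE_I2) (simp add: abs_mult mult_left_mono)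
    show "AE x in lborel. (\<lambda>n. (r x)\<^sup>2 * ?\<eta> n x) \<longlonglongrightarrow> (r x)\<^sup>2"
    proof (intro AE_I2 tendsto_eventually)
      fix x
      obtain N where N: "real N > \<bar>x\<bar>" using reals_Archimedean2 by blast
      then have "(r x)\<^sup>2 * ?\<eta> n x = (r x)\<^sup>2" if "n \<ge> N" for n
        using \<eta>S(3)[of x n] that by simp
      then show "\<forall>\<^sub>F n in sequentially. (r x)\<^sup>2 * ?\<eta> n x = (r x)\<^sup>2"
        by (rule eventually_sequentiallyI)
    qed
  qed measurable
  moreover have "(\<lambda>n. LINT x|lborel. r x * vderiv (?\<eta> n) x) \<longlonglongrightarrow> 0"
  proof -
    let ?I = "\<lambda>n x. indicator {x. \<bar>x\<bar> \<ge> real (Suc n)} x :: real"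
    have tail: "(\<lambda>n. LINT x|lborel. (r x)\<^sup>2 * ?I n x) \<longlonglongrightarrow> (LINT x|(lborel :: real measure). 0 :: real)"
    proof (rule integral_dominated_convergence[where w = "\<lambda>x. (r x)\<^sup>2"])
      show "integrable lborel (\<lambda>x. (r x)\<^sup>2)" by (rule r2)
      show "AE x in lborel. norm ((r x)\<^sup>2 * ?I n x) \<le> (r x)\<^sup>2" for n
        by (intro AE_I2) (simp add: indicator_def)
      show "AE x in lborel. (\<lambda>n. (r x)\<^sup>2 * ?I n x) \<longlonglongrightarrow> 0"
      proof (intro AE_I2 tendsto_eventually)
        fix x
        obtain N where "real N > \<bar>x\<bar>" using reals_Archimedean2 by blast
        then have "(r x)\<^sup>2 * ?I n x = 0" if "n \<ge> N" for n using that by simp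
        then show "\<forall>\<^sub>F n in sequentially. (r x)\<^sup>2 * ?I n x = 0"
          by (rule eventually_sequentiallyI)
      qed
    qed measurable
    have CS: "(LINT x|lborel. r x * vderiv (?\<eta> n) x)\<^sup>2 \<le> (LINT x|lborel. (r x)\<^sup>2 * ?I n x) * 16" for n
    proof -
      let ?d = "vderiv (?\<eta> n)"
      have d: "?d \<in> test_functions" by (intro test_vderiv \<eta>S)
      have int1: "integrable lborel (\<lambda>x. (r x)\<^sup>2 * ?I n x)"
      proof (rule Bochner_Integration.integrable_bound[OF r2])
        show "AE x in lborel. norm ((r x)\<^sup>2 * ?I n x) \<le> norm ((r x)\<^sup>2)"
          by (intro AE_I2) (simp add: indicator_def)
      qed measurable
      note int2 = L2_integrable_mult(1)[OF r d]
      note int3 = test_integrable[OF test_power2[OF d]]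
      have "(LINT x|lborel. r x * ?d x)\<^sup>2 \<le> (LINT x|lborel. (r x)\<^sup>2 * ?I n x) * (LINT x|lborel. (?d x)\<^sup>2)"
      proof (rule quadratic_nonneg_discriminant)
        fix t
        have "0 \<le> (LINT x|lborel. (r x * ?I n x + t * ?d x)\<^sup>2)" by simp
        \<comment> \<open>The derivative \<open>?d\<close> vanishes where the tail indicator does,
          so the cross term is unaffected by the indicator.\<close>
        also have "\<dots> = (LINT x|lborel. (r x)\<^sup>2 * ?I n x + 2 * t * (r x * ?d x) + t\<^sup>2 * (?d x)\<^sup>2)"
        proof (intro Bochner_Integration.integral_cong refl)
          fix x
          show "(r x * ?I n x + t * ?d x)\<^sup>2 = (r x)\<^sup>2 * ?I n x + 2 * t * (r x * ?d x) + t\<^sup>2 * (?d x)\<^sup>2"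
            using cutoff_vderiv_zero[OF \<eta>, of "Suc n" x]
            by (cases "\<bar>x\<bar> < real (Suc n)") (auto simp: indicator_def power2_eq_square algebra_simps)
        qed
        also have "\<dots> = (LINT x|lborel. (r x)\<^sup>2 * ?I n x) + 2 * t * (LINT x|lborel. r x * ?d x)
            + t\<^sup>2 * (LINT x|lborel. (?d x)\<^sup>2)"
          using int1 int2 int3 by simp
        finally show "0 \<le> (LINT x|lborel. (r x)\<^sup>2 * ?I n x) + 2 * t * (LINT x|lborel. r x * ?d x)
            + t\<^sup>2 * (LINT x|lborel. (?d x)\<^sup>2)" .
      qed simp
      \<comment> \<open>The transition region always consists of two unit intervals, so this bound
        is uniform in \<open>n\<close>.\<close>
      moreover have "(LINT x|lborel. (?d x)\<^sup>2) \<le> (LINT x|lborel.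
          8 * (indicator {real (Suc n)..real (Suc n) + 1} x + indicator {- real (Suc n) - 1..- real (Suc n)} x))"
      proof (rule Bochner_Integration.integral_mono[OF int3])
        fix x
        have "(?d x)\<^sup>2 \<le> 2 * \<bar>?d x\<bar>"
          using mult_right_mono[OF \<eta>S(5)[of n x], of "\<bar>?d x\<bar>"] by (simp add: power2_eq_square)
        then show "(?d x)\<^sup>2 \<le> 8 * (indicator {real (Suc n)..real (Suc n) + 1} x
            + indicator {- real (Suc n) - 1..- real (Suc n)} x)"
          using cutoff_vderiv_le[OF \<eta>, of "Suc n" x] by (simp add: indicator_def)
      qed simp
      then have "(LINT x|lborel. (?d x)\<^sup>2) \<le> 16" by simp
      moreover have "0 \<le> (LINT x|lborel. (r x)\<^sup>2 * ?I n x)" by simp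
      ultimately show ?thesis by (meson mult_left_mono order.trans)
    qed
    show ?thesis
    proof (rule Lim_null_comparison)
      show "\<forall>\<^sub>F n in sequentially. norm (LINT x|lborel. r x * vderiv (?\<eta> n) x)
          \<le> sqrt ((LINT x|lborel. (r x)\<^sup>2 * ?I n x) * 16)"
        using CS by (intro always_eventually allI) (simp add: real_le_rsqrt)
      show "(\<lambda>n. sqrt ((LINT x|lborel. (r x)\<^sup>2 * ?I n x) * 16)) \<longlonglongrightarrow> 0"
        using tendsto_real_sqrt[OF tendsto_mult_right[OF tail, of 16]] by simp
    qed
  qed
  ultimately have "(\<lambda>n. - (LINT x|lborel. r x * vderiv (?\<eta> n) x) + (LINT x|lborel. (r x)\<^sup>2 * ?\<eta> n x))
      \<longlonglongrightarrow> - 0 + (LINT x|lborel. (r x)\<^sup>2)"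
    by (intro tendsto_add tendsto_minus)
  then have "(\<lambda>n. Miura r (?\<eta> n)) \<longlonglongrightarrow> (LINT x|lborel. (r x)\<^sup>2)"
    using \<eta>S(1) by (simp add: Miura_def)
  then show ?thesis by (rule LIMSEQ_imp_Suc)
qed

section \<open>Translation invariance and global square integrability\<close>

lemma test_translate:
  fixes \<phi> :: "real \<Rightarrow> real"
  assumes \<phi>: "\<phi> \<in> test_functions"
  shows "(\<lambda>x. \<phi> (x - c)) \<in> test_functions"
    and "vderiv (\<lambda>x. \<phi> (x - c)) x = vderiv \<phi> (x - c)"
proof -
  obtain M where M: "smooth \<phi>" "\<And>x. \<bar>x\<bar> \<ge> M \<Longrightarrow> \<phi> x = 0" using test_functionE[OF \<phi>] by metis
  have "smooth (\<lambda>x. \<phi> (x - c))"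
    using smooth_compose[OF M(1) smooth_affine[of 1 "- c"]] by simp
  then show "(\<lambda>x. \<phi> (x - c)) \<in> test_functions"
    by (rule test_functionI[of _ "M + \<bar>c\<bar>"]) (auto intro!: M(2))
  show "vderiv (\<lambda>x. \<phi> (x - c)) x = vderiv \<phi> (x - c)"
    using DERIV_shift[of \<phi> "vderiv \<phi> (x - c)" x "- c"] smooth_DERIV[OF M(1), of "x - c"]
    by (intro DERIV_vderiv) simp
qed

lemma lborel_integral_translate:
  fixes f :: "real \<Rightarrow> real"
  shows "(LINT x|lborel. f (x - c)) = (LINT x|lborel. f x)"
  using lborel_integral_real_affine[of 1 f "- c"] by simp

lemma H1_norm_translate:
  "\<phi> \<in> test_functions \<Longrightarrow> H1_norm (\<lambda>x. \<phi> (x - c)) = H1_norm \<phi>"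
  unfolding H1_norm_def test_translate(2)
  using lborel_integral_translate[of "\<lambda>x. (\<phi> x)\<^sup>2" c] lborel_integral_translate[of "\<lambda>x. (vderiv \<phi> x)\<^sup>2" c]
  by simp

text \<open>Translates of a fixed bump have the same H1 norm, so the energy bound is uniform over
  intervals of length two. The term with the derivative of \<eta> n meets two such intervals and
  stays bounded; monotone convergence concludes.\<close>

lemma square_integrable_of_bounded_cutoff:
  assumes q: "q \<in> H_minus1" and \<eta>: "cutoff_sequence \<eta>" and conv: "special_integral_exists \<eta> q"
    and [measurable]: "r \<in> borel_measurable borel"
    and loc: "\<And>k::nat. integrable lborel (\<lambda>x. (r x)\<^sup>2 * indicator {- real k..real k} x)"
    and eq: "\<And>\<psi>. \<psi> \<in> test_functions \<Longrightarrow>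
      (LINT x|lborel. (r x)\<^sup>2 * \<psi> x) = q \<psi> + (LINT x|lborel. r x * vderiv \<psi> x)"
  shows "integrable lborel (\<lambda>x. (r x)\<^sup>2)"
proof -
  obtain C where C: "\<And>\<psi>. \<psi> \<in> test_functions \<Longrightarrow> \<bar>q \<psi>\<bar> \<le> C * H1_norm \<psi>"
    using q unfolding H_minus1_def by blast
  have int: "integrable lborel (\<lambda>x. (r x)\<^sup>2 * h x)"
    if [measurable]: "h \<in> borel_measurable borel" and hL: "\<And>x. \<bar>h x\<bar> \<le> L"
      and h0: "\<And>x. \<bar>x\<bar> > M \<Longrightarrow> h x = 0" for h :: "real \<Rightarrow> real" and L M
  proof -
    obtain k :: nat where k: "real k > M" using reals_Archimedean2 by blast
    show ?thesis
    proof (rule Bochner_Integration.integrable_bound)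
      show "integrable lborel (\<lambda>x. L * ((r x)\<^sup>2 * indicator {- real k..real k} x))"
        using loc by simp
      show "AE x in lborel. norm ((r x)\<^sup>2 * h x) \<le> norm (L * ((r x)\<^sup>2 * indicator {- real k..real k} x))"
      proof (rule AE_I2)
        fix x
        show "norm ((r x)\<^sup>2 * h x) \<le> norm (L * ((r x)\<^sup>2 * indicator {- real k..real k} x))"
        proof (cases "\<bar>x\<bar> > M")
          case False
          then have "x \<in> {- real k..real k}" using k by auto
          moreover have "\<bar>h x\<bar> \<le> \<bar>L\<bar>" using hL[of x] by linarith
          ultimately show ?thesis
            by (simp add: abs_mult mult.commute[of "\<bar>L\<bar>"] mult_left_mono)
        qed (simp add: h0)
      qed
    qed measurable
  qed
  have int_test: "integrable lborel (\<lambda>x. (r x)\<^sup>2 * h x)" if h: "h \<in> test_functions" for h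
  proof -
    obtain L where "\<And>x. \<bar>h x\<bar> \<le> L" using test_bounded[OF h] by blast
    moreover obtain M where "\<And>x. \<bar>x\<bar> \<ge> M \<Longrightarrow> h x = 0" using test_functionE[OF h] by metis
    ultimately show ?thesis
      using smooth_borel_measurable[OF test_smooth[OF h]] by (intro int[of h L M]) auto
  qed
  note \<eta>1 = cutoff_sequence_test[OF \<eta> order_refl]
  \<comment> \<open>The right-hand side of \<open>local_energy_bound\<close> for a translate of
    \<eta> 1, with \<open>q\<close> estimated by its H1 bound. Both terms are independent of the
    translation.\<close>
  define E where "E = 2 * (C * H1_norm (\<lambda>x. (\<eta> 1 x)\<^sup>2)) + 4 * (LINT x|lborel. (vderiv (\<eta> 1) x)\<^sup>2)"
  have unit: "(LINT x|lborel. (r x)\<^sup>2 * indicator {c - 1..c + 1} x) \<le> E" for c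
  proof -
    let ?\<theta> = "\<lambda>x. \<eta> 1 (x - c)"
    have \<theta>: "?\<theta> \<in> test_functions" by (rule test_translate[OF \<eta>1(1)])
    note \<theta>2 = test_power2[OF \<theta>]
    have "(LINT x|lborel. (r x)\<^sup>2 * indicator {c - 1..c + 1} x) \<le> (LINT x|lborel. (r x)\<^sup>2 * (?\<theta> x)\<^sup>2)"
    proof (rule integral_mono'[OF int_test[OF \<theta>2]])
      fix x
      show "(r x)\<^sup>2 * indicator {c - 1..c + 1} x \<le> (r x)\<^sup>2 * (?\<theta> x)\<^sup>2"
      proof (cases "x \<in> {c - 1..c + 1}")
        case True
        then have "?\<theta> x = 1" by (intro \<eta>1(3)) auto
        then show ?thesis by (simp add: indicator_def)
      qed simp
    qed simp
    also have "\<dots> \<le> 2 * q (\<lambda>x. (?\<theta> x)\<^sup>2) + 4 * (LINT x|lborel. (vderiv ?\<theta> x)\<^sup>2)"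
      by (rule local_energy_bound[OF \<theta> int_test[OF \<theta>2] eq[OF \<theta>2]])
    also have "(LINT x|lborel. (vderiv ?\<theta> x)\<^sup>2) = (LINT x|lborel. (vderiv (\<eta> 1) x)\<^sup>2)"
      unfolding test_translate(2)[OF \<eta>1(1)]
      by (rule lborel_integral_translate[of "\<lambda>x. (vderiv (\<eta> 1) x)\<^sup>2"])
    also have "q (\<lambda>x. (?\<theta> x)\<^sup>2) \<le> C * H1_norm (\<lambda>x. (\<eta> 1 x)\<^sup>2)"
      using C[OF \<theta>2] H1_norm_translate[OF test_power2[OF \<eta>1(1)], of c] by (simp add: abs_le_iff)
    finally show ?thesis by (simp add: E_def)
  qed
  \<comment> \<open>Existence of the special integral enters here, as a bound on the convergent
    sequence.\<close>
  obtain A where A: "\<And>n. \<bar>q (\<eta> n)\<bar> \<le> A"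
    using convergent_imp_Bseq[OF conv[unfolded special_integral_exists_def]] by (auto simp: Bseq_def)
  \<comment> \<open>The transition intervals are enlarged to length two around \<open>real n\<close>
    and \<open>- real n\<close>, the shape treated by \<open>unit\<close>. Their total length is the
    constant \<open>4\<close> below.\<close>
  let ?J = "\<lambda>n x. indicator {real n - 1..real n + 1} x + indicator {- real n - 1..- real n + 1} x :: real"
  have bound: "(LINT x|lborel. (r x)\<^sup>2 * indicator {- real n..real n} x) \<le> A + 4 + 2 * E"
    if n: "n \<ge> 1" for n
  proof -
    note \<eta>n = cutoff_sequence_test[OF \<eta> n]
    have int_unit: "integrable lborel (\<lambda>x. (r x)\<^sup>2 * indicator {real n - 1..real n + 1} x)"
      "integrable lborel (\<lambda>x. (r x)\<^sup>2 * indicator {- real n - 1..- real n + 1} x)"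
      by (intro int[of _ 1 "real n + 1"]; auto simp: indicator_def)+
    have "(LINT x|lborel. (r x)\<^sup>2 * indicator {- real n..real n} x) \<le> (LINT x|lborel. (r x)\<^sup>2 * \<eta> n x)"
    proof (rule integral_mono'[OF int_test[OF \<eta>n(1)]])
      fix x
      show "(r x)\<^sup>2 * indicator {- real n..real n} x \<le> (r x)\<^sup>2 * \<eta> n x"
        using \<eta>n(2,3)[of x] by (auto simp: indicator_def)
    qed (simp add: \<eta>n)
    also have "\<dots> = q (\<eta> n) + (LINT x|lborel. r x * vderiv (\<eta> n) x)"
      by (rule eq[OF \<eta>n(1)])
    also have "(LINT x|lborel. r x * vderiv (\<eta> n) x) \<le>
        (LINT x|lborel. ?J n x + ((r x)\<^sup>2 * indicator {real n - 1..real n + 1} x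
          + (r x)\<^sup>2 * indicator {- real n - 1..- real n + 1} x))"
    proof (rule integral_mono')
      show "integrable lborel (\<lambda>x. ?J n x + ((r x)\<^sup>2 * indicator {real n - 1..real n + 1} x
          + (r x)\<^sup>2 * indicator {- real n - 1..- real n + 1} x))"
        by (intro Bochner_Integration.integrable_add int_unit) simp_all
      fix x
      have "\<bar>vderiv (\<eta> n) x\<bar> \<le> 2 * ?J n x"
        by (rule order.trans[OF cutoff_vderiv_le[OF \<eta> n]]) (intro mult_left_mono add_mono indicator_leI; auto)
      then have "\<bar>r x\<bar> * \<bar>vderiv (\<eta> n) x\<bar> \<le> \<bar>r x\<bar> * (2 * ?J n x)"
        by (rule mult_left_mono) simp
      also have "\<dots> \<le> (1 + (r x)\<^sup>2) * ?J n x"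
        using mult_right_mono[of "2 * \<bar>r x\<bar>" "1 + (r x)\<^sup>2" "?J n x"] zero_le_power2[of "\<bar>r x\<bar> - 1"]
        by (simp add: power2_eq_square algebra_simps)
      finally show "r x * vderiv (\<eta> n) x \<le> ?J n x + ((r x)\<^sup>2 * indicator {real n - 1..real n + 1} x
          + (r x)\<^sup>2 * indicator {- real n - 1..- real n + 1} x)"
        using abs_ge_self[of "r x * vderiv (\<eta> n) x"] by (simp add: abs_mult algebra_simps)
    qed (simp add: indicator_def)
    also have "\<dots> = 4 + ((LINT x|lborel. (r x)\<^sup>2 * indicator {real n - 1..real n + 1} x)
          + (LINT x|lborel. (r x)\<^sup>2 * indicator {- real n - 1..- real n + 1} x))"
      using int_unit by simp
    also have "\<dots> \<le> 4 + (E + E)"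
      using unit[of "real n"] unit[of "- real n"] by (intro add_mono order_refl) simp_all
    finally show ?thesis using A[of n] by (simp add: abs_le_iff)
  qed
  \<comment> \<open>The index starts at one because \<open>bound\<close> requires a genuine member
    of the cutoff sequence.\<close>
  let ?f = "\<lambda>n x. (r x)\<^sup>2 * indicator {- real (Suc n)..real (Suc n)} x"
  have "incseq (\<lambda>n. integral\<^sup>L lborel (?f n))"
    by (intro incseq_SucI Bochner_Integration.integral_mono loc) (auto simp: indicator_def)
  moreover have "\<forall>n. integral\<^sup>L lborel (?f n) \<le> A + 4 + 2 * E"
    using bound[of "Suc n" for n] by simp
  ultimately obtain L where "(\<lambda>n. integral\<^sup>L lborel (?f n)) \<longlonglongrightarrow> L"
    by (rule incseq_convergent)
  then show ?thesis
  proof (rule integrable_monotone_convergence[OF loc[of "Suc n" for n], rotated 2])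
    show "AE x in lborel. mono (\<lambda>n. ?f n x)"
      by (intro AE_I2 incseq_SucI) (auto simp: indicator_def)
    show "AE x in lborel. (\<lambda>n. ?f n x) \<longlonglongrightarrow> (r x)\<^sup>2"
    proof (intro AE_I2 tendsto_eventually)
      fix x
      obtain N where N: "real N > \<bar>x\<bar>" using reals_Archimedean2 by blast
      then have "?f n x = (r x)\<^sup>2" if "n \<ge> N" for n using that by (auto simp: indicator_def)
      then show "\<forall>\<^sub>F n in sequentially. ?f n x = (r x)\<^sup>2" by (rule eventually_sequentiallyI)
    qed
  qed simp
qed

theorem theorem4p5:
  fixes \<eta> :: "nat \<Rightarrow> real \<Rightarrow> real"
  assumes "cutoff_sequence \<eta>"
  shows "(\<forall>q\<in>H_minus1.
            q \<in> Im_Miura \<longleftrightarrow> Schroedinger_nonneg q \<and> special_integral_exists \<eta> q) \<and>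
         (\<forall>q\<in>Im_Miura. special_integral_exists \<eta> q \<and> special_integral \<eta> q \<ge> 0)"
proof -
  \<comment> \<open>The limit along the cutoffs is the integral of \<open>r^2\<close>, which yields
    existence and sign of the special integral at once.\<close>
  have image: "Schroedinger_nonneg q \<and> special_integral_exists \<eta> q \<and> special_integral \<eta> q \<ge> 0"
    if q: "q \<in> Im_Miura" for q
  proof -
    obtain r where r: "r \<in> L2_functions" "q = Miura r"
      using q by (auto simp: Im_Miura_def)
    note lim = Miura_cutoff_tendsto[OF r(1) assms]
    have "special_integral_exists \<eta> q"
      using lim by (auto simp: special_integral_exists_def convergent_def r(2))
    moreover have "special_integral \<eta> q \<ge> 0"
      using limI[OF lim] by (simp add: special_integral_def r(2))
    ultimately show ?thesis using Miura_nonneg[OF r(1)] r(2) by simp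
  qed
  have preimage: "q \<in> Im_Miura"
    if q: "q \<in> H_minus1" and nonneg: "Schroedinger_nonneg q" and conv: "special_integral_exists \<eta> q" for q
  proof -
    obtain r where r: "r \<in> borel_measurable borel"
        "\<And>k::nat. integrable lborel (\<lambda>x. (r x)\<^sup>2 * indicator {- real k..real k} x)"
      and eq: "\<And>\<psi>. \<psi> \<in> test_functions \<Longrightarrow>
        (LINT x|lborel. (r x)\<^sup>2 * \<psi> x) = q \<psi> + (LINT x|lborel. r x * vderiv \<psi> x)"
      using local_Miura_preimage[OF q nonneg assms] by blast
    have "r \<in> L2_functions"
      using r(1) square_integrable_of_bounded_cutoff[OF q assms conv r eq]
      by (simp add: L2_functions_def)
    \<comment> \<open>Agreement on test functions is the weak equation; off test functions both
      functionals take the default value of extensional functions.\<close>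
    moreover have "q = Miura r"
    proof (rule extensionalityI)
      show "q \<in> extensional test_functions"
        using q by (simp add: H_minus1_def distributions_def)
    qed (simp_all add: Miura_def eq)
    ultimately show ?thesis by (auto simp: Im_Miura_def)
  qed
  show ?thesis using image preimage by blast
qed

end
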